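(* There is an algorithm that, given as input a directed acyclic graph $G=(V,E)$ (whose width $k$ is not given as input), computes a maximum antichain of $G$ in time $O(k^2 4^k |V| + k 2^k |E|)$, where $k$ is the width of $G$.
   Context: A path in a directed graph is a sequence of distinct vertices $v_1,\ldots,v_\ell$ ($\ell\ge 1$) with $(v_j,v_{j+1})\in E$ for all $j$; a vertex $u$ reaches $v$ if there is a path starting at $u$ and ending at $v$ (so every vertex reaches itself). An antichain is a set of vertices such that no vertex of the set reaches a different vertex of the set. The width $k$ of a DAG is the maximum size of an antichain; a maximum antichain is an antichain of size $k$. *)

theory Defs
  imports "Graph_Theory.Pair_Digraph"
begin

section \<open>Antichains and width of directed acyclic graphs\<close>

definition dag :: "'a pair_pre_digraph \<Rightarrow> bool" where
  "dag G \<longleftrightarrow> pair_fin_digraph G \<and> acyclic (parcs G)"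

text \<open>An \<open>apath\<close> is a walk along arcs of \<open>G\<close> whose sequence of vertices is distinct; the empty
  walk at a vertex of \<open>G\<close> is one.\<close>

definition reaches :: "'a pair_pre_digraph \<Rightarrow> 'a \<Rightarrow> 'a \<Rightarrow> bool" where
  "reaches G u v \<longleftrightarrow> (\<exists>p. pre_digraph.apath (with_proj G) u p v)"

definition antichain :: "'a pair_pre_digraph \<Rightarrow> 'a set \<Rightarrow> bool" where
  "antichain G A \<longleftrightarrow> A \<subseteq> pverts G \<and> (\<forall>u\<in>A. \<forall>v\<in>A. u \<noteq> v \<longrightarrow> \<not> reaches G u v)"

definition width :: "'a pair_pre_digraph \<Rightarrow> nat" where
  "width G = Max (card ` {A. antichain G A})"

definition max_antichain :: "'a pair_pre_digraph \<Rightarrow> 'a set \<Rightarrow> bool" where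
  "max_antichain G A \<longleftrightarrow> antichain G A \<and> card A = width G"


section \<open>A word RAM\<close>

text \<open>
  Algorithms are programs of a structured language for a random access machine: finitely many
  registers, and finitely many arrays (each program mentions only finitely many names) with
  constant-time indexed access. Every operation, test, read and write costs one time unit.
  The machine works with \<open>w\<close>-bit words: a computation that would produce a value
  \<open>\<ge> 2 ^ w\<close>, even as an intermediate result or as an array index, gets stuck. A program
  therefore cannot gain anything from large numbers, and cannot observe \<open>w\<close>.
\<close>

datatype aexp =
    Const nat
  | Reg string
  | Read string aexp
  | Plus aexp aexp
  | Minus aexp aexp
  | Times aexp aexp

datatype bexp =
    Less aexp aexp
  | Equal aexp aexp
  | Neg bexp
  | Conj bexp bexp

datatype com =
    Skip
  | Assign string aexp
  | Write string aexp aexp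
  | Seq com com
  | If bexp com com
  | While bexp com

record state =
  reg :: "string \<Rightarrow> nat"
  arr :: "string \<Rightarrow> nat \<Rightarrow> nat"

text \<open>Subtraction is truncated at \<open>0\<close>.\<close>

fun aval :: "aexp \<Rightarrow> state \<Rightarrow> nat" where
  "aval (Const n) s = n"
| "aval (Reg x) s = reg s x"
| "aval (Read a e) s = arr s a (aval e s)"
| "aval (Plus e f) s = aval e s + aval f s"
| "aval (Minus e f) s = aval e s - aval f s"
| "aval (Times e f) s = aval e s * aval f s"

fun bval :: "bexp \<Rightarrow> state \<Rightarrow> bool" where
  "bval (Less e f) s \<longleftrightarrow> aval e s < aval f s"
| "bval (Equal e f) s \<longleftrightarrow> aval e s = aval f s"
| "bval (Neg b) s \<longleftrightarrow> \<not> bval b s"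
| "bval (Conj b c) s \<longleftrightarrow> bval b s \<and> bval c s"

fun afits :: "nat \<Rightarrow> aexp \<Rightarrow> state \<Rightarrow> bool" where
  "afits w (Const n) s \<longleftrightarrow> n < 2 ^ w"
| "afits w (Reg x) s \<longleftrightarrow> reg s x < 2 ^ w"
| "afits w (Read a e) s \<longleftrightarrow> afits w e s \<and> aval (Read a e) s < 2 ^ w"
| "afits w (Plus e f) s \<longleftrightarrow> afits w e s \<and> afits w f s \<and> aval (Plus e f) s < 2 ^ w"
| "afits w (Minus e f) s \<longleftrightarrow> afits w e s \<and> afits w f s"
| "afits w (Times e f) s \<longleftrightarrow> afits w e s \<and> afits w f s \<and> aval (Times e f) s < 2 ^ w"

fun bfits :: "nat \<Rightarrow> bexp \<Rightarrow> state \<Rightarrow> bool" where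
  "bfits w (Less e f) s \<longleftrightarrow> afits w e s \<and> afits w f s"
| "bfits w (Equal e f) s \<longleftrightarrow> afits w e s \<and> afits w f s"
| "bfits w (Neg b) s \<longleftrightarrow> bfits w b s"
| "bfits w (Conj b c) s \<longleftrightarrow> bfits w b s \<and> bfits w c s"

fun acost :: "aexp \<Rightarrow> nat" where
  "acost (Const n) = 1"
| "acost (Reg x) = 1"
| "acost (Read a e) = acost e + 1"
| "acost (Plus e f) = acost e + acost f + 1"
| "acost (Minus e f) = acost e + acost f + 1"
| "acost (Times e f) = acost e + acost f + 1"

fun bcost :: "bexp \<Rightarrow> nat" where
  "bcost (Less e f) = acost e + acost f + 1"
| "bcost (Equal e f) = acost e + acost f + 1"
| "bcost (Neg b) = bcost b + 1"
| "bcost (Conj b c) = bcost b + bcost c + 1"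

text \<open>\<open>exec w c s t s'\<close>: on a machine with \<open>w\<close>-bit words, program \<open>c\<close> started in state \<open>s\<close> halts
  after \<open>t\<close> time units in state \<open>s'\<close>.\<close>

inductive exec :: "nat \<Rightarrow> com \<Rightarrow> state \<Rightarrow> nat \<Rightarrow> state \<Rightarrow> bool" for w where
  Skip: "exec w Skip s 1 s"
| Assign: "afits w e s \<Longrightarrow>
    exec w (Assign x e) s (acost e + 1) (s\<lparr>reg := (reg s)(x := aval e s)\<rparr>)"
| Write: "afits w e s \<Longrightarrow> afits w f s \<Longrightarrow>
    exec w (Write a e f) s (acost e + acost f + 1)
      (s\<lparr>arr := (arr s)(a := (arr s a)(aval e s := aval f s))\<rparr>)"
| Seq: "exec w c1 s t1 s1 \<Longrightarrow> exec w c2 s1 t2 s2 \<Longrightarrow>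
    exec w (Seq c1 c2) s (t1 + t2) s2"
| IfTrue: "bfits w b s \<Longrightarrow> bval b s \<Longrightarrow> exec w c1 s t s1 \<Longrightarrow>
    exec w (If b c1 c2) s (bcost b + 1 + t) s1"
| IfFalse: "bfits w b s \<Longrightarrow> \<not> bval b s \<Longrightarrow> exec w c2 s t s1 \<Longrightarrow>
    exec w (If b c1 c2) s (bcost b + 1 + t) s1"
| WhileFalse: "bfits w b s \<Longrightarrow> \<not> bval b s \<Longrightarrow>
    exec w (While b c) s (bcost b + 1) s"
| WhileTrue: "bfits w b s \<Longrightarrow> bval b s \<Longrightarrow> exec w c s t1 s1 \<Longrightarrow>
    exec w (While b c) s1 t2 s2 \<Longrightarrow>
    exec w (While b c) s (bcost b + 1 + t1 + t2) s2"

inductive_cases SkipE: "exec w Skip s t s'"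
  and AssignE: "exec w (Assign x e) s t s'"
  and WriteE: "exec w (Write a e f) s t s'"
  and SeqE: "exec w (Seq c1 c2) s t s'"
  and IfE: "exec w (If b c1 c2) s t s'"
  and WhileE: "exec w (While b c) s t s'"

lemma exec_deterministic:
  "exec w c s t s' \<Longrightarrow> exec w c s u s'' \<Longrightarrow> u = t \<and> s'' = s'"
proof (induction arbitrary: u s'' rule: exec.induct)
  case (Skip s)
  then show ?case by (auto elim: SkipE)
next
  case (Assign e s x)
  from Assign.prems show ?case by (rule AssignE) simp
next
  case (Write e s f a)
  from Write.prems show ?case by (rule WriteE) simp
next
  case (Seq c1 s t1 s1 c2 t2 s2)
  from Seq.prems show ?case
    by (rule SeqE) (use Seq.IH in fastforce)
next
  case (IfTrue b s c1 t s1 c2)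
  from IfTrue.prems show ?case
    by (rule IfE) (use IfTrue.hyps IfTrue.IH in fastforce)+
next
  case (IfFalse b s c2 t s1 c1)
  from IfFalse.prems show ?case
    by (rule IfE) (use IfFalse.hyps IfFalse.IH in fastforce)+
next
  case (WhileFalse b s c)
  from WhileFalse.prems show ?case
    by (rule WhileE) (use WhileFalse.hyps in simp_all)
next
  case (WhileTrue b s c t1 s1 t2 s2)
  from WhileTrue.prems show ?case
    by (rule WhileE) (use WhileTrue.hyps WhileTrue.IH in fastforce)+
qed

lemma afits_mono:
  assumes "w \<le> w'" shows "afits w e s \<Longrightarrow> afits w' e s"
proof -
  have "x < 2 ^ w \<Longrightarrow> x < 2 ^ w'" for x :: nat
    using assms by (meson less_le_trans one_le_numeral power_increasing)
  then show "afits w e s \<Longrightarrow> afits w' e s"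
    by (induction e) auto
qed

lemma bfits_mono:
  assumes "w \<le> w'" shows "bfits w b s \<Longrightarrow> bfits w' b s"
  by (induction b) (auto intro: afits_mono[OF assms])

lemma exec_mono:
  assumes "w \<le> w'" shows "exec w c s t s' \<Longrightarrow> exec w' c s t s'"
  by (induction rule: exec.induct)
    (rule exec.intros; (assumption | erule afits_mono[OF assms] bfits_mono[OF assms]))+


section \<open>Input and output\<close>

text \<open>A graph on the vertices \<open>0, \<dots>, n - 1\<close> is given by \<open>n\<close> and by the list of its arcs, in any
  order; all remaining memory is \<open>0\<close>.\<close>

definition represents :: "nat \<Rightarrow> (nat \<times> nat) list \<Rightarrow> nat pair_pre_digraph \<Rightarrow> bool" where
  "represents n es G \<longleftrightarrow> pverts G = {..<n} \<and> parcs G = set es \<and> distinct es"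

definition input_state :: "nat \<Rightarrow> (nat \<times> nat) list \<Rightarrow> state" where
  "input_state n es =
    \<lparr>reg = (\<lambda>_. 0)(''n'' := n, ''m'' := length es),
     arr = (\<lambda>_ _. 0)
       (''tail'' := (\<lambda>i. if i < length es then fst (es ! i) else 0),
        ''head'' := (\<lambda>i. if i < length es then snd (es ! i) else 0))\<rparr>"

definition output_list :: "state \<Rightarrow> nat list" where
  "output_list s = map (arr s ''out'') [0..<reg s ''size'']"

text \<open>
  \<open>P\<close> runs in time \<open>O(T)\<close> on a machine with words of \<open>O(log T)\<close> bits, which is what it takes to
  address the memory that can be used in time \<open>T\<close>; the \<open>+ 2\<close> only ensures that constants fit.
  The time clause excludes the graph without vertices, for which \<open>T = 0\<close>.
\<close>

definition computes_max_antichain_in_time ::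
    "com \<Rightarrow> (nat pair_pre_digraph \<Rightarrow> nat) \<Rightarrow> bool" where
  "computes_max_antichain_in_time P T \<longleftrightarrow>
    (\<exists>c d. \<forall>G n es w. dag G \<longrightarrow> represents n es G \<longrightarrow> (T G + 2) ^ d \<le> 2 ^ w \<longrightarrow>
      (\<exists>t s. exec w P (input_state n es) t s \<and>
        distinct (output_list s) \<and> max_antichain G (set (output_list s)) \<and>
        (pverts G \<noteq> {} \<longrightarrow> t \<le> c * T G)))"

end

theory Submission
  imports Defs
begin

text \<open>
  Say that an antichain \<open>Y\<close> dominates an antichain \<open>X\<close> of the same size if every vertex of \<open>Y\<close>
  is reached from \<open>X\<close>. By Dilworth's theorem the graph is covered by \<open>k\<close> chains, and an undominated
  antichain is determined by the set of chains that it meets; so there are at most \<open>2 ^ k\<close> undominated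
  antichains, and every maximum antichain is dominated by one of them.

  The algorithm sweeps over the vertices in topological order and maintains the undominated
  antichains of the vertices seen so far. When \<open>v\<close> arrives, they are to be found among the old ones
  and the sets \<open>A \<union> {v}\<close> with \<open>A\<close> old and not reaching \<open>v\<close>. Since \<open>v\<close> reaches no earlier vertex,
  domination among these candidates can be read off the domination matrix of the old antichains, which
  makes \<open>O(4 ^ k)\<close> work per vertex. To decide which antichains reach \<open>v\<close>, every vertex keeps the
  list of all members of the current antichains (at most \<open>k * 2 ^ k\<close> many) that reach it; the list of
  \<open>v\<close> is put together from the lists of its in-neighbours, in \<open>O(k * 2 ^ k)\<close> per arc. A vertex that is in
  none of the current antichains never occurs in a later one, so nothing is lost. The topological order is
  obtained by repeatedly removing sinks, for which the in-neighbour lists suffice as well.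
\<close>

section \<open>Undominated antichains\<close>

text \<open>Dilworth's theorem only counts here: no chain is ever computed, and \<open>k\<close>
  occurs in the analysis alone, which is why the width need not be an input. The work per vertex
  must not depend on the number of earlier vertices. Hence the reach list of a vertex is never
  revised, even though it may keep vertices that have left the frontier, and each domination matrix
  is derived from its predecessor without a further reachability query. The other obstacle is the
  bounded word. Correctness and iteration counts are proved for words as long as a run happens to
  need (\<open>wp\<close>). Independently, \<open>exec_slow\<close> shows that if every stored value
  exceeds the numbers in memory by at most a constant, then memory contents stay linear in the
  running time and addresses polynomial in it, so that \<open>O(log T)\<close> bits suffice. This
  shapes the program: matrix entries are written through a pointer that is incremented, and products
  occur only inside addresses.\<close>

locale porder =
  fixes r :: "'a rel"
  assumes refl_r: "refl r" and trans_r: "trans r" and antisym_r: "antisym r"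
begin

definition indep :: "'a set \<Rightarrow> bool" where
  "indep X \<longleftrightarrow> (\<forall>a\<in>X. \<forall>b\<in>X. (a, b) \<in> r \<longrightarrow> a = b)"

lemma r_refl [simp]: "(a, a) \<in> r"
  using refl_r by (simp add: refl_on_def)

lemma r_trans: "(a, b) \<in> r \<Longrightarrow> (b, c) \<in> r \<Longrightarrow> (a, c) \<in> r"
  using trans_r by (rule transD)

lemma r_antisym: "(a, b) \<in> r \<Longrightarrow> (b, a) \<in> r \<Longrightarrow> a = b"
  using antisym_r by (rule antisymD)

lemma up_self: "x \<in> X \<Longrightarrow> x \<in> r `` X"
  using r_refl by blast

lemma indepD: "indep X \<Longrightarrow> a \<in> X \<Longrightarrow> b \<in> X \<Longrightarrow> (a, b) \<in> r \<Longrightarrow> a = b"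
  by (auto simp: indep_def)

lemma indep_subset: "indep X \<Longrightarrow> Y \<subseteq> X \<Longrightarrow> indep Y"
  by (auto simp: indep_def)

lemma indep_insert:
  "indep (insert a X) \<longleftrightarrow> indep X \<and> (\<forall>x\<in>X. x \<noteq> a \<longrightarrow> (a, x) \<notin> r \<and> (x, a) \<notin> r)"
  by (auto simp: indep_def)

lemma up_trans: "Y \<subseteq> r `` X \<Longrightarrow> Z \<subseteq> r `` Y \<Longrightarrow> Z \<subseteq> r `` X"
  using r_trans by blast

text \<open>A member \<open>x\<close> has some \<open>y\<close> of the other set below it, and
  \<open>y\<close> has some \<open>x'\<close> of the first set below it. Independence forces
  \<open>x' = x\<close>, and then \<open>y = x\<close>.\<close>

lemma up_antisym:
  assumes "indep X" "indep Y" "Y \<subseteq> r `` X" "X \<subseteq> r `` Y"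
  shows "X = Y"
proof -
  have "X' \<subseteq> Y'" if X': "indep X'" "Y' \<subseteq> r `` X'" "X' \<subseteq> r `` Y'" for X' Y'
  proof
    fix x assume "x \<in> X'"
    then obtain y where y: "y \<in> Y'" "(y, x) \<in> r" using X'(3) by blast
    then obtain x' where x': "x' \<in> X'" "(x', y) \<in> r" using X'(2) by blast
    then have "x' = x"
      using X'(1) \<open>x \<in> X'\<close> y by (meson indepD r_trans)
    then show "x \<in> Y'" using x' y r_antisym by blast
  qed
  then show ?thesis using assms by blast
qed

lemma ex_maximal:
  assumes "finite V" "a \<in> V"
  shows "\<exists>m\<in>V. (a, m) \<in> r \<and> (\<forall>x\<in>V. (m, x) \<in> r \<longrightarrow> x = m)"
proof -
  define f where "f x = card {y \<in> V. (x, y) \<in> r}" for x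
  \<comment> \<open>Going upwards the up-set shrinks, so a point above \<open>a\<close> with the
    smallest up-set is maximal.\<close>
  obtain m where m: "m \<in> V \<and> (a, m) \<in> r" "\<And>y. y \<in> V \<and> (a, y) \<in> r \<Longrightarrow> f m \<le> f y"
    using ex_has_least_nat[of "\<lambda>x. x \<in> V \<and> (a, x) \<in> r" a f] assms by auto
  have "x = m" if x: "x \<in> V" "(m, x) \<in> r" for x
  proof -
    have "f m \<le> f x" using x m by (blast intro: r_trans)
    moreover have "{y \<in> V. (x, y) \<in> r} \<subseteq> {y \<in> V. (m, y) \<in> r}"
      using x by (blast intro: r_trans)
    ultimately have "{y \<in> V. (x, y) \<in> r} = {y \<in> V. (m, y) \<in> r}"
      unfolding f_def using assms(1) by (intro card_seteq) auto
    then have "(x, m) \<in> r" using m by auto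
    then show ?thesis using x by (blast dest: r_antisym)
  qed
  then show ?thesis using m by blast
qed

section \<open>Chain decompositions and Dilworth's theorem\<close>

definition chain_partition :: "'a set \<Rightarrow> nat \<Rightarrow> ('a \<Rightarrow> nat) \<Rightarrow> bool" where
  "chain_partition V k f \<longleftrightarrow>
    f ` V \<subseteq> {..<k} \<and> (\<forall>a\<in>V. \<forall>b\<in>V. f a = f b \<longrightarrow> (a, b) \<in> r \<or> (b, a) \<in> r)"

text \<open>Colour \<open>k\<close> is fresh for the chain \<open>K\<close>. Classes may be empty,
  so the number of colours is only an upper bound and any \<open>l > k\<close> will do.\<close>

lemma chain_partition_add:
  assumes "chain_partition (V - K) k f" "\<And>a b. a \<in> K \<Longrightarrow> b \<in> K \<Longrightarrow> (a, b) \<in> r \<or> (b, a) \<in> r"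
    "k < l"
  shows "chain_partition V l (\<lambda>x. if x \<in> K then k else f x)"
proof -
  have "f a < k" if "a \<in> V" "a \<notin> K" for a
    using assms(1) that by (auto simp: chain_partition_def)
  then show ?thesis
    using assms unfolding chain_partition_def
    by (smt (verit, ccfv_SIG) DiffI image_subset_iff lessThan_iff less_trans nat_neq_iff)
qed

lemma chain_partition_inj:
  assumes "chain_partition V k f" "X \<subseteq> V" "indep X" shows "inj_on f X"
proof (rule inj_onI)
  fix x y assume "x \<in> X" "y \<in> X" "f x = f y"
  then show "x = y"
    using assms unfolding chain_partition_def by (metis indepD subsetD)
qed

text \<open>Galvin's proof of Dilworth's theorem.\<close>

lemma dilworth:
  assumes "finite V" "\<And>X. X \<subseteq> V \<Longrightarrow> indep X \<Longrightarrow> card X \<le> k"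
  shows "\<exists>f. chain_partition V k f"
  using assms
proof (induction V arbitrary: k rule: finite_psubset_induct)
  case (psubset V)
  show ?case
  proof (cases "V = {}")
    case True
    then show ?thesis by (simp add: chain_partition_def)
  next
    case False
    then obtain a where a: "a \<in> V" "\<And>x. x \<in> V \<Longrightarrow> (a, x) \<in> r \<Longrightarrow> x = a"
      using ex_maximal[OF psubset.hyps] by blast
    define V' where "V' = V - {a}"
    have V': "V' \<subset> V" "finite V'" using a psubset.hyps by (auto simp: V'_def)
    show ?thesis
    proof (cases "\<exists>X\<subseteq>V'. indep X \<and> card X = k")
      \<comment> \<open>Every antichain of \<open>V'\<close> has fewer than \<open>k\<close> points,
        so \<open>k - 1\<close> chains cover \<open>V'\<close> and \<open>a\<close> can be a chain
        of its own.\<close>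
      case False
      have le: "card X \<le> k - 1" if "X \<subseteq> V'" "indep X" for X
        using False that psubset.prems[of X] V' by fastforce
      have "0 < k" using False by (metis card.empty empty_subsetI gr0I indep_def empty_iff)
      obtain f where "chain_partition V' (k - 1) f"
        using psubset.IH[OF V'(1) le] by blast
      then have "chain_partition V k (\<lambda>x. if x \<in> {a} then k - 1 else f x)"
        using \<open>0 < k\<close> by (intro chain_partition_add) (auto simp: V'_def)
      then show ?thesis by blast
    next
      case True
      then obtain X0 where X0: "X0 \<subseteq> V'" "indep X0" "card X0 = k" by blast
      obtain f where f: "chain_partition V' k f"
        using psubset.IH[OF V'(1), of k] psubset.prems V' by auto
      have onto: "\<exists>x\<in>X. f x = i" if "X \<subseteq> V'" "indep X" "card X = k" "i < k" for X i
      proof -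
        have "f ` X \<subseteq> {..<k}" using f that by (auto simp: chain_partition_def)
        moreover have "card (f ` X) = k"
          using chain_partition_inj[OF f that(1,2)] that by (simp add: card_image)
        ultimately have "f ` X = {..<k}" by (simp add: card_subset_eq)
        then show ?thesis using \<open>i < k\<close> by (metis imageE lessThan_iff)
      qed
      \<comment> \<open>\<open>S i\<close> collects the points of chain \<open>i\<close> that lie on
        an antichain of size \<open>k\<close> in \<open>V'\<close>. Such an antichain meets every
        chain, so \<open>S i\<close> is nonempty; being a finite chain, it has a greatest point,
        later called \<open>x i\<close>.\<close>
      define S where "S i = {x \<in> V'. f x = i \<and> (\<exists>X\<subseteq>V'. indep X \<and> card X = k \<and> x \<in> X)}" for i
      have "\<exists>x\<in>S i. \<forall>y\<in>S i. (y, x) \<in> r" if "i < k" for i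
      proof -
        obtain b where "b \<in> S i" using onto[OF X0 \<open>i < k\<close>] X0 by (auto simp: S_def)
        moreover have fin: "finite (S i)" using V' by (simp add: S_def)
        ultimately obtain m where m: "m \<in> S i" "\<And>x. x \<in> S i \<Longrightarrow> (m, x) \<in> r \<Longrightarrow> x = m"
          using ex_maximal[OF fin] by blast
        have "(y, m) \<in> r" if "y \<in> S i" for y
        proof -
          have "(y, m) \<in> r \<or> (m, y) \<in> r"
            using that m(1) f by (simp add: S_def chain_partition_def)
          then show ?thesis using m(2) that by auto
        qed
        then show ?thesis using m(1) by blast
      qed
      then obtain x where x: "\<And>i. i < k \<Longrightarrow> x i \<in> S i"
        "\<And>i y. i < k \<Longrightarrow> y \<in> S i \<Longrightarrow> (y, x i) \<in> r" by metis
      have xV: "x i \<in> V'" "f (x i) = i" if "i < k" for i using x(1)[OF that] by (auto simp: S_def)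
      \<comment> \<open>An antichain of size \<open>k\<close> through \<open>x j\<close> meets chain
        \<open>i\<close> in some \<open>y\<close> of \<open>S i\<close>. Then \<open>y\<close> is
        below \<open>x i\<close>, hence below \<open>x j\<close>, hence equal to it:
        \<open>i\<close> and \<open>j\<close> name the same chain.\<close>
      have "x i = x j" if ij: "i < k" "j < k" "(x i, x j) \<in> r" for i j
      proof -
        obtain X where X: "X \<subseteq> V'" "indep X" "card X = k" "x j \<in> X"
          using x(1)[OF ij(2)] by (auto simp: S_def)
        obtain y where y: "y \<in> X" "f y = i" using onto[OF X(1-3) ij(1)] by blast
        then have "y \<in> S i" using X by (auto simp: S_def)
        then have "(y, x j) \<in> r" using x(2)[OF ij(1)] ij(3) r_trans by metis
        then have "y = x j" using indepD[OF X(2) y(1) X(4)] by simp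
        then show ?thesis using y xV ij by auto
      qed
      then have indA: "indep (x ` {..<k})" by (auto simp: indep_def)
      have cardA: "card (x ` {..<k}) = k"
        using card_image[of x "{..<k}"] xV by (metis card_lessThan inj_onI lessThan_iff)
      have AV: "x ` {..<k} \<subseteq> V'" using xV by auto
      have "\<exists>i<k. (x i, a) \<in> r"
      proof (rule ccontr)
        assume "\<not> ?thesis"
        moreover have "(a, x i) \<notin> r" if "i < k" for i
          using a(2)[of "x i"] xV[OF that] by (auto simp: V'_def)
        ultimately have "indep (insert a (x ` {..<k}))" using indA by (auto simp: indep_insert)
        moreover have "insert a (x ` {..<k}) \<subseteq> V" using AV a by (auto simp: V'_def)
        moreover have "card (insert a (x ` {..<k})) = Suc k"
          using AV cardA by (subst card_insert_disjoint) (auto simp: V'_def)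
        ultimately have "Suc k \<le> k" using psubset.prems by metis
        then show False by simp
      qed
      then obtain i where i: "i < k" "(x i, a) \<in> r" by blast
      \<comment> \<open>Chain \<open>i\<close> up to \<open>x i\<close>, topped by \<open>a\<close>.
        Its removal leaves no antichain of size \<open>k\<close>: one would meet chain
        \<open>i\<close> in a point of \<open>S i\<close>, which is below \<open>x i\<close> and so
        in \<open>K\<close>.\<close>
      define K where "K = insert a {z \<in> V'. f z = i \<and> (z, x i) \<in> r}"
      have "V - K \<subset> V" using a by (auto simp: K_def)
      moreover have "card X \<le> k - 1" if X: "X \<subseteq> V - K" "indep X" for X
      proof (rule ccontr)
        assume "\<not> ?thesis"
        moreover have "card X \<le> k" using psubset.prems[of X] X by blast
        ultimately have "card X = k" by linarith
        moreover have "X \<subseteq> V'" using X by (auto simp: K_def V'_def)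
        ultimately obtain y where "y \<in> X" "f y = i" using onto X i by blast
        then have "y \<in> S i" using \<open>X \<subseteq> V'\<close> \<open>card X = k\<close> X by (auto simp: S_def)
        then have "y \<in> K" using x(2)[OF i(1)] by (auto simp: K_def S_def)
        then show False using X \<open>y \<in> X\<close> by auto
      qed
      ultimately obtain g where "chain_partition (V - K) (k - 1) g" using psubset.IH by metis
      moreover have "(b, c) \<in> r \<or> (c, b) \<in> r" if "b \<in> K" "c \<in> K" for b c
      proof -
        have "(z, a) \<in> r" if "z \<in> K" for z
          using that i r_trans[of z "x i" a] by (auto simp: K_def)
        moreover have "(b, c) \<in> r \<or> (c, b) \<in> r" if "b \<noteq> a" "c \<noteq> a"
          using that \<open>b \<in> K\<close> \<open>c \<in> K\<close> f by (auto simp: K_def chain_partition_def)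
        ultimately show ?thesis using that by metis
      qed
      ultimately have "chain_partition V k (\<lambda>x. if x \<in> K then k - 1 else g x)"
        using i by (intro chain_partition_add) auto
      then show ?thesis by blast
    qed
  qed
qed

section \<open>Undominated antichains and their number\<close>

definition antis :: "'a set \<Rightarrow> 'a set set" where
  "antis V = {X. X \<subseteq> V \<and> indep X}"

text \<open>Only sets of equal size compete, so antichains of every attainable size are kept. The
  smaller ones matter because later vertices may extend them.\<close>

definition front :: "'a set \<Rightarrow> 'a set set" where
  "front V = {X \<in> antis V. \<forall>Y\<in>antis V. card Y = card X \<longrightarrow> Y \<subseteq> r `` X \<longrightarrow> Y = X}"

lemma front_eqI:
  assumes "X \<in> front V" "Y \<subseteq> V" "indep Y" "card Y = card X" "Y \<subseteq> r `` X"
  shows "Y = X"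
  using assms by (auto simp: front_def antis_def)

lemma frontD: "X \<in> front V \<Longrightarrow> X \<subseteq> V" "X \<in> front V \<Longrightarrow> indep X"
  by (auto simp: front_def antis_def)

text \<open>Among the antichains of this size that dominate \<open>X\<close>, take one with the
  smallest up-set in \<open>V\<close>. Whatever dominates it has the same up-set, so the two
  dominate each other and \<open>up_antisym\<close> applies.\<close>

lemma front_dominates:
  assumes "finite V" "X \<subseteq> V" "indep X"
  shows "\<exists>Y\<in>front V. card Y = card X \<and> Y \<subseteq> r `` X"
proof -
  define P where "P Y \<longleftrightarrow> Y \<in> antis V \<and> card Y = card X \<and> Y \<subseteq> r `` X" for Y
  define f where "f Y = card (r `` Y \<inter> V)" for Y
  have "X \<subseteq> r `` X" by (auto intro: up_self)
  then have "P X" using assms by (auto simp: P_def antis_def)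
  then obtain Y where Y: "P Y" "\<And>Z. P Z \<Longrightarrow> f Y \<le> f Z"
    using ex_has_least_nat[of P X f] by blast
  have "Z = Y" if Z: "Z \<in> antis V" "card Z = card Y" "Z \<subseteq> r `` Y" for Z
  proof -
    have "P Z" using Z Y(1) up_trans[of Y X Z] unfolding P_def by simp
    then have "f Y \<le> f Z" by (rule Y)
    moreover have "r `` Z \<inter> V \<subseteq> r `` Y \<inter> V" using Z by (blast intro: r_trans)
    ultimately have "r `` Z \<inter> V = r `` Y \<inter> V"
      unfolding f_def using assms(1) by (intro card_seteq) auto
    moreover have "Y \<subseteq> r `` Y \<inter> V" using Y(1) by (auto simp: P_def antis_def intro: up_self)
    ultimately have "Y \<subseteq> r `` Z" by blast
    then show ?thesis using Z Y(1) by (intro up_antisym) (auto simp: P_def antis_def)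
  qed
  then have "Y \<in> front V" using Y(1) by (auto simp: front_def P_def)
  then show ?thesis using Y(1) by (auto simp: P_def)
qed

text \<open>Two frontier antichains that meet the same chains coincide: both are dominated by
  the antichain that takes the larger of their elements on every chain.\<close>

lemma front_support_inj:
  assumes f: "chain_partition V k f" and fin: "finite V"
  shows "inj_on ((`) f) (front V)"
proof (rule inj_onI)
  fix X Y assume X: "X \<in> front V" and Y: "Y \<in> front V" and eq: "f ` X = f ` Y"
  define J where "J = (X \<union> Y) \<inter> r `` X \<inter> r `` Y"
  have XV: "X \<subseteq> V" "indep X" and YV: "Y \<subseteq> V" "indep Y" using X Y by (auto dest: frontD)
  \<comment> \<open>\<open>b\<close> lies in \<open>X\<close> or in \<open>Y\<close>, and
    \<open>a\<close> is above some \<open>z\<close> of that same set. Then \<open>z\<close> is below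
    \<open>b\<close>, so they coincide and \<open>a\<close> is squeezed between them.\<close>
  have "a = b" if "a \<in> J" "b \<in> J" "(a, b) \<in> r" for a b
  proof -
    have key: "a = b" if Z: "indep Z" "b \<in> Z" "a \<in> r `` Z" for Z
    proof -
      obtain z where z: "z \<in> Z" "(z, a) \<in> r" using Z by blast
      then have "(z, b) \<in> r" using \<open>(a, b) \<in> r\<close> by (blast intro: r_trans)
      then have "z = b" using Z z by (blast dest: indepD)
      then show ?thesis using z \<open>(a, b) \<in> r\<close> by (blast dest: r_antisym)
    qed
    show ?thesis using key[of X] key[of Y] that XV YV by (auto simp: J_def)
  qed
  then have indJ: "indep J" by (auto simp: indep_def)
  have JV: "J \<subseteq> V" using XV YV by (auto simp: J_def)
  have "f ` J = f ` X"
  proof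
    show "f ` J \<subseteq> f ` X" using eq by (auto simp: J_def)
    show "f ` X \<subseteq> f ` J"
    proof
      fix c assume "c \<in> f ` X"
      then obtain x y where x: "x \<in> X" "f x = c" and y: "y \<in> Y" "f y = c" using eq by force
      then have "(x, y) \<in> r \<or> (y, x) \<in> r"
        using f XV YV unfolding chain_partition_def by (metis subsetD)
      moreover have "y \<in> J" if "(x, y) \<in> r" using that x y up_self by (auto simp: J_def)
      moreover have "x \<in> J" if "(y, x) \<in> r" using that x y up_self by (auto simp: J_def)
      ultimately have "y \<in> J \<or> x \<in> J" by blast
      then show "c \<in> f ` J" using x y by (metis imageI)
    qed
  qed
  then have "card J = card X"
    using chain_partition_inj[OF f JV indJ] chain_partition_inj[OF f XV]
    by (metis card_image)
  moreover have "card Y = card X"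
    using chain_partition_inj[OF f YV] chain_partition_inj[OF f XV] eq
    by (metis card_image)
  ultimately have "J = X" "J = Y"
    using front_eqI[OF X JV indJ] front_eqI[OF Y JV indJ] by (auto simp: J_def)
  then show "X = Y" by simp
qed

lemma card_front_le:
  assumes "finite V" "\<And>X. X \<subseteq> V \<Longrightarrow> indep X \<Longrightarrow> card X \<le> k"
  shows "card (front V) \<le> 2 ^ k"
proof -
  obtain f where f: "chain_partition V k f" using dilworth assms by blast
  have "(`) f ` front V \<subseteq> Pow {..<k}"
    using f by (fastforce simp: chain_partition_def dest: frontD)
  then have "card (front V) \<le> card (Pow {..<k})"
    by (intro card_inj_on_le[OF front_support_inj[OF f assms(1)]]) auto
  then show ?thesis by (simp add: card_Pow)
qed

lemma front_empty: "front {} = {{}}"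
  by (auto simp: front_def antis_def indep_def)

section \<open>Adding a vertex that reaches no earlier one\<close>

definition cands :: "'a set \<Rightarrow> 'a \<Rightarrow> 'a set set" where
  "cands V v = front V \<union> insert v ` {Y \<in> front V. v \<notin> r `` Y}"

context
  fixes V :: "'a set" and v :: 'a
  assumes fin: "finite V" and v: "v \<notin> V" "\<And>x. x \<in> V \<Longrightarrow> (v, x) \<notin> r"
begin

lemma cands_antis: "X \<in> cands V v \<Longrightarrow> X \<subseteq> insert v V \<and> indep X"
proof -
  assume X: "X \<in> cands V v"
  have "indep (insert v Y)" if "Y \<in> front V" "v \<notin> r `` Y" for Y
    using that frontD[OF that(1)] v by (auto simp: indep_insert)
  then show ?thesis using X by (auto simp: cands_def dest: frontD)
qed

text \<open>If \<open>X\<close> contains \<open>v\<close>, replace \<open>X - {v}\<close> by a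
  member \<open>Z\<close> of \<open>front V\<close> that dominates it. Were \<open>v\<close> reached
  from \<open>Z\<close>, it would be reached from \<open>X - {v}\<close>; so
  \<open>insert v Z\<close> is again a candidate.\<close>

lemma cands_dominate:
  assumes "X \<subseteq> insert v V" "indep X"
  shows "\<exists>Z\<in>cands V v. card Z = card X \<and> Z \<subseteq> r `` X"
proof (cases "v \<in> X")
  case False
  then show ?thesis
    using front_dominates[OF fin, of X] assms by (auto simp: cands_def)
next
  case True
  define Y where "Y = X - {v}"
  have Y: "Y \<subseteq> V" "indep Y" "X = insert v Y" "v \<notin> Y"
    using True assms by (auto simp: Y_def elim: indep_subset)
  obtain Z where Z: "Z \<in> front V" "card Z = card Y" "Z \<subseteq> r `` Y"
    using front_dominates[OF fin Y(1,2)] by blast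
  have "(y, v) \<notin> r" if "y \<in> Y" for y
    using that Y assms(2) by (auto dest: indepD)
  then have nv: "v \<notin> r `` Z" using Z(3) by (blast intro: r_trans)
  have "finite Y" "finite Z" "v \<notin> Z"
    using Y Z(1) fin v by (auto dest: frontD intro: finite_subset)
  then have "card (insert v Z) = card X" using Z Y by simp
  moreover have "insert v Z \<in> cands V v" using Z nv by (auto simp: cands_def)
  moreover have "insert v Z \<subseteq> r `` X" using Z Y r_refl by blast
  ultimately show ?thesis by blast
qed

text \<open>Comparing candidates with each other suffices: an antichain that dominates a candidate
  is itself dominated by a candidate, and \<open>up_antisym\<close> closes the circle.\<close>

lemma front_insert:
  "front (insert v V) =
    {X \<in> cands V v. \<forall>Z\<in>cands V v. card Z = card X \<longrightarrow> Z \<subseteq> r `` X \<longrightarrow> Z = X}" (is "?L = ?R")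
proof
  show "?L \<subseteq> ?R"
  proof
    fix X assume X: "X \<in> ?L"
    obtain Z where Z: "Z \<in> cands V v" "card Z = card X" "Z \<subseteq> r `` X"
      using cands_dominate[of X] X by (auto dest: frontD)
    then have "Z = X" using front_eqI[OF X] cands_antis by blast
    then show "X \<in> ?R" using Z front_eqI[OF X] cands_antis by blast
  qed
  show "?R \<subseteq> ?L"
  proof
    fix X assume X: "X \<in> ?R"
    have "Y = X" if Y: "Y \<in> antis (insert v V)" "card Y = card X" "Y \<subseteq> r `` X" for Y
    proof -
      obtain Z where Z: "Z \<in> cands V v" "card Z = card Y" "Z \<subseteq> r `` Y"
        using cands_dominate[of Y] Y by (auto simp: antis_def)
      then have "Z = X" using X Y by (metis (mono_tags, lifting) mem_Collect_eq up_trans)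
      then show ?thesis
        using Y Z X cands_antis[of X] by (intro up_antisym) (auto simp: antis_def)
    qed
    then show "X \<in> ?L" using X cands_antis[of X] by (auto simp: front_def antis_def)
  qed
qed

text \<open>Since \<open>v\<close> reaches nothing in \<open>V\<close>, it helps to cover no old
  vertex; the only new question is whether \<open>X\<close> reaches \<open>v\<close>. This is why
  the old matrix and one bit per antichain determine the new matrix.\<close>

lemma up_insert_cases:
  assumes "X \<subseteq> V" "Y \<subseteq> V"
  shows "insert v Y \<subseteq> r `` X \<longleftrightarrow> Y \<subseteq> r `` X \<and> v \<in> r `` X"
    and "Y \<subseteq> r `` insert v X \<longleftrightarrow> Y \<subseteq> r `` X"
    and "insert v Y \<subseteq> r `` insert v X \<longleftrightarrow> Y \<subseteq> r `` X"
  using assms v by (auto simp: Image_iff subset_iff)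

end

end

section \<open>Word size, running time and loop rules\<close>

fun const_bound :: "aexp \<Rightarrow> bool" where
  "const_bound (Const n) \<longleftrightarrow> n \<le> 2"
| "const_bound (Reg x) \<longleftrightarrow> True"
| "const_bound (Read a e) \<longleftrightarrow> const_bound e"
| "const_bound (Plus e f) \<longleftrightarrow> const_bound e \<and> const_bound f"
| "const_bound (Minus e f) \<longleftrightarrow> const_bound e \<and> const_bound f"
| "const_bound (Times e f) \<longleftrightarrow> const_bound e \<and> const_bound f"

fun const_bound_b :: "bexp \<Rightarrow> bool" where
  "const_bound_b (Less e f) \<longleftrightarrow> const_bound e \<and> const_bound f"
| "const_bound_b (Equal e f) \<longleftrightarrow> const_bound e \<and> const_bound f"
| "const_bound_b (Neg b) \<longleftrightarrow> const_bound_b b"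
| "const_bound_b (Conj b c) \<longleftrightarrow> const_bound_b b \<and> const_bound_b c"

text \<open>The expressions whose value may be stored: it exceeds the largest number in memory by
  a constant at most. Addresses and tests are not restricted.\<close>

fun slow :: "aexp \<Rightarrow> bool" where
  "slow (Const n) \<longleftrightarrow> n \<le> 2"
| "slow (Reg x) \<longleftrightarrow> True"
| "slow (Read a e) \<longleftrightarrow> const_bound e"
| "slow (Plus e f) \<longleftrightarrow> slow e \<and> (\<exists>n\<le>2. f = Const n)"
| "slow (Minus e f) \<longleftrightarrow> slow e \<and> const_bound f"
| "slow (Times e f) \<longleftrightarrow> False"

fun slow_com :: "com \<Rightarrow> bool" where
  "slow_com Skip \<longleftrightarrow> True"
| "slow_com (Assign x e) \<longleftrightarrow> slow e"
| "slow_com (Write a e f) \<longleftrightarrow> const_bound e \<and> slow f"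
| "slow_com (Seq c d) \<longleftrightarrow> slow_com c \<and> slow_com d"
| "slow_com (If b c d) \<longleftrightarrow> const_bound_b b \<and> slow_com c \<and> slow_com d"
| "slow_com (While b c) \<longleftrightarrow> const_bound_b b \<and> slow_com c"

text \<open>Up to this factor, the running time is the number of loop iterations plus one.\<close>

fun unit_cost :: "com \<Rightarrow> nat" where
  "unit_cost Skip = 1"
| "unit_cost (Assign x e) = acost e + 1"
| "unit_cost (Write a e f) = acost e + acost f + 1"
| "unit_cost (Seq c d) = unit_cost c + unit_cost d"
| "unit_cost (If b c d) = bcost b + 1 + unit_cost c + unit_cost d"
| "unit_cost (While b c) = bcost b + 1 + unit_cost c"

definition bounded :: "nat \<Rightarrow> state \<Rightarrow> bool" where
  "bounded M s \<longleftrightarrow> (\<forall>x. reg s x \<le> M) \<and> (\<forall>a i. arr s a i \<le> M)"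

text \<open>Every operation costs one unit and thus buys one more factor \<open>M\<close>, which for
  \<open>M \<ge> 2\<close> also absorbs the doubling caused by a sum. The degree of this polynomial
  bound depends on the program text alone.\<close>

lemma const_bound_fits:
  assumes "bounded M s" "2 \<le> M" "const_bound e"
  shows "aval e s \<le> M ^ acost e \<and> (M ^ acost e < 2 ^ w \<longrightarrow> afits w e s)"
  using assms(3)
proof (induction e)
  case (Const n)
  then show ?case using assms by auto
next
  case (Reg x)
  have "reg s x \<le> M" using assms by (simp add: bounded_def)
  then show ?case using le_less_trans[of "reg s x" M "2 ^ w"] by simp
next
  case (Read a e)
  have "M ^ acost e \<le> M ^ acost (Read a e)" "M \<le> M ^ acost (Read a e)"
    using assms(2) by auto
  moreover have "arr s a (aval e s) \<le> M" using assms by (simp add: bounded_def)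
  ultimately show ?case using Read by (auto simp del: acost.simps intro: le_less_trans)
next
  case (Plus e f)
  have le: "M ^ acost e \<le> M ^ (acost e + acost f)" "M ^ acost f \<le> M ^ (acost e + acost f)"
    using assms(2) by (auto intro!: power_increasing)
  have "M ^ acost e + M ^ acost f \<le> 2 * M ^ (acost e + acost f)" using le by linarith
  also have "\<dots> \<le> M ^ acost (Plus e f)" using assms(2) by simp
  finally have "M ^ acost e + M ^ acost f \<le> M ^ acost (Plus e f)" .
  then show ?case using Plus by (auto simp del: acost.simps)
next
  case (Minus e f)
  have le: "M ^ acost e \<le> M ^ acost (Minus e f)" "M ^ acost f \<le> M ^ acost (Minus e f)"
    using assms(2) by (auto intro!: power_increasing simp del: power_Suc)
  then show ?case using Minus by (auto simp del: acost.simps)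
next
  case (Times e f)
  have le: "M ^ acost e \<le> M ^ acost (Times e f)" "M ^ acost f \<le> M ^ acost (Times e f)"
    using assms(2) by (auto intro!: power_increasing simp del: power_Suc)
  have "M ^ acost e * M ^ acost f \<le> M ^ acost (Times e f)"
    using assms(2) by (simp add: power_add)
  moreover have "aval e s * aval f s \<le> M ^ acost e * M ^ acost f"
    using Times by (auto intro: mult_mono)
  ultimately show ?case using Times le by (auto simp del: acost.simps)
qed

lemma const_bound_b_fits:
  assumes "bounded M s" "2 \<le> M" "const_bound_b b" "M ^ bcost b < 2 ^ w"
  shows "bfits w b s"
  using assms(3,4)
proof (induction b)
  case (Less e f)
  have "M ^ acost e \<le> M ^ bcost (Less e f)" "M ^ acost f \<le> M ^ bcost (Less e f)"
    using assms(2) by (auto intro!: power_increasing simp del: power_Suc)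
  then show ?case using Less const_bound_fits[OF assms(1,2)] by (auto simp del: bcost.simps)
next
  case (Equal e f)
  have "M ^ acost e \<le> M ^ bcost (Equal e f)" "M ^ acost f \<le> M ^ bcost (Equal e f)"
    using assms(2) by (auto intro!: power_increasing simp del: power_Suc)
  then show ?case using Equal const_bound_fits[OF assms(1,2)] by (auto simp del: bcost.simps)
next
  case (Neg b)
  have "M ^ bcost b \<le> M ^ bcost (Neg b)"
    using assms(2) by (auto intro!: power_increasing simp del: power_Suc)
  then show ?case using Neg by (auto simp del: bcost.simps)
next
  case (Conj b c)
  have "M ^ bcost b \<le> M ^ bcost (Conj b c)" "M ^ bcost c \<le> M ^ bcost (Conj b c)"
    using assms(2) by (auto intro!: power_increasing simp del: power_Suc)
  then show ?case using Conj by (auto simp del: bcost.simps)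
qed

lemma slow_const_bound: "slow e \<Longrightarrow> const_bound e"
  by (induction e) auto

text \<open>The growth is additive per time unit. Storing sums or products of memory contents could
  double or square the largest number at each step.\<close>

lemma slow_growth:
  assumes "bounded M s" "2 \<le> M" "slow e"
  shows "aval e s \<le> M + 2 * acost e"
  using assms(3)
proof (induction e)
  case (Read a e)
  have "arr s a (aval e s) \<le> M" using assms by (simp add: bounded_def)
  then show ?case by simp
next
  case (Reg x)
  have "reg s x \<le> M" using assms by (simp add: bounded_def)
  then show ?case by simp
qed (use assms in auto)

lemma power_less_mono:
  "b ^ n < c \<Longrightarrow> a \<le> b \<Longrightarrow> m \<le> n \<Longrightarrow> 1 \<le> b \<Longrightarrow> a ^ m < (c :: nat)"
  by (meson le_less_trans le_trans power_increasing power_mono zero_le)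

lemma bounded_mono: "bounded M s \<Longrightarrow> M \<le> M' \<Longrightarrow> bounded M' s"
  by (meson bounded_def le_trans)

text \<open>A program that only stores slowly growing values never overflows words
  whose size is logarithmic in its running time.\<close>

lemma exec_slow:
  assumes "exec w' c s t s'" "bounded M s" "slow_com c" "2 \<le> M"
    "(M + 2 * t) ^ unit_cost c < 2 ^ w"
  shows "exec w c s t s' \<and> bounded (M + 2 * t) s'"
  using assms
\<comment> \<open>\<open>M\<close> varies because a later part of the run starts from the bound
  \<open>M + 2 * t1\<close> that the earlier part leaves behind.\<close>
proof (induction arbitrary: M rule: exec.induct)
  case (Skip s)
  then show ?case using exec.Skip[of w s] bounded_mono[of M s "M + 2 * 1"] by simp
next
  case (Assign e s x)
  have "M ^ acost e < 2 ^ w"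
    using Assign.prems(3) by (intro power_less_mono[OF Assign.prems(4)]) auto
  then have "afits w e s"
    using const_bound_fits[of M s e w] Assign slow_const_bound by auto
  moreover have "bounded (M + 2 * (acost e + 1)) (s\<lparr>reg := (reg s)(x := aval e s)\<rparr>)"
    using slow_growth[of M s e] Assign bounded_mono[of M s "M + 2 * (acost e + 1)"]
    by (auto simp: bounded_def)
  ultimately show ?case by (intro conjI exec.Assign)
next
  case (Write e s f a)
  let ?M = "M + 2 * (acost e + acost f + 1)"
  have "M ^ acost e < 2 ^ w" "M ^ acost f < 2 ^ w"
    using Write.prems(3) by (intro power_less_mono[OF Write.prems(4)]; simp)+
  then have "afits w e s" "afits w f s"
    using const_bound_fits[of M s _ w] Write slow_const_bound[of f] by auto
  moreover have "bounded ?M (s\<lparr>arr := (arr s)(a := (arr s a)(aval e s := aval f s))\<rparr>)"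
    using slow_growth[of M s f] Write bounded_mono[of M s ?M]
    by (auto simp: bounded_def)
  ultimately show ?case by (intro conjI exec.Write)
next
  case (Seq c1 s t1 s1 c2 t2 s2)
  have "(M + 2 * t1) ^ unit_cost c1 < 2 ^ w" "(M + 2 * t1 + 2 * t2) ^ unit_cost c2 < 2 ^ w"
    using Seq.prems(3) by (intro power_less_mono[OF Seq.prems(4)]; simp)+
  then have "exec w c1 s t1 s1 \<and> bounded (M + 2 * t1) s1"
    "exec w c2 s1 t2 s2 \<and> bounded (M + 2 * t1 + 2 * t2) s2"
    using Seq.IH(1)[of M] Seq.IH(2)[of "M + 2 * t1"] Seq.prems by auto
  moreover have "M + 2 * t1 + 2 * t2 = M + 2 * (t1 + t2)" by simp
  ultimately show ?case using exec.Seq[of w c1 s t1 s1 c2 t2 s2] by metis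
next
  case (IfTrue b s c1 t s1 c2)
  have *: "(M + 2 * t) ^ unit_cost c1 < 2 ^ w" "M ^ bcost b < 2 ^ w"
    using IfTrue.prems(3) by (intro power_less_mono[OF IfTrue.prems(4)]; simp)+
  then have "exec w c1 s t s1 \<and> bounded (M + 2 * t) s1" using IfTrue.IH[of M] IfTrue.prems by auto
  moreover have "bfits w b s" using const_bound_b_fits[of M s b w] IfTrue.prems * by auto
  ultimately show ?case using IfTrue.hyps
    by (intro conjI exec.IfTrue) (auto elim!: bounded_mono)
next
  case (IfFalse b s c2 t s1 c1)
  have *: "(M + 2 * t) ^ unit_cost c2 < 2 ^ w" "M ^ bcost b < 2 ^ w"
    using IfFalse.prems(3) by (intro power_less_mono[OF IfFalse.prems(4)]; simp)+
  then have "exec w c2 s t s1 \<and> bounded (M + 2 * t) s1" using IfFalse.IH[of M] IfFalse.prems by auto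
  moreover have "bfits w b s" using const_bound_b_fits[of M s b w] IfFalse.prems * by auto
  ultimately show ?case using IfFalse.hyps
    by (intro conjI exec.IfFalse) (auto elim!: bounded_mono)
next
  case (WhileFalse b s c)
  have "M ^ bcost b < 2 ^ w"
    using WhileFalse.prems(3) by (intro power_less_mono[OF WhileFalse.prems(4)]) auto
  then have "bfits w b s" using const_bound_b_fits[of M s b w] WhileFalse.prems by auto
  then show ?case using WhileFalse
    by (intro conjI exec.WhileFalse) (auto elim!: bounded_mono)
next
  case (WhileTrue b s c t1 s1 t2 s2)
  have *: "(M + 2 * t1) ^ unit_cost c < 2 ^ w" "M ^ bcost b < 2 ^ w"
    "(M + 2 * t1 + 2 * t2) ^ unit_cost (While b c) < 2 ^ w"
    using WhileTrue.prems(3) by (intro power_less_mono[OF WhileTrue.prems(4)]; simp)+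
  have 1: "exec w c s t1 s1 \<and> bounded (M + 2 * t1) s1"
    using WhileTrue.IH(1)[of M] WhileTrue.prems * by auto
  then have 2: "exec w (While b c) s1 t2 s2 \<and> bounded (M + 2 * t1 + 2 * t2) s2"
    using WhileTrue.IH(2)[of "M + 2 * t1"] WhileTrue.prems * by auto
  have "bfits w b s" using const_bound_b_fits[of M s b w] WhileTrue.prems * by auto
  then show ?case using 1 2 WhileTrue.hyps(2)
    by (intro conjI exec.WhileTrue) (auto elim!: bounded_mono)
qed

section \<open>Frame conditions and total correctness with iteration counts\<close>

fun regs_of :: "com \<Rightarrow> string set" where
  "regs_of Skip = {}"
| "regs_of (Assign x e) = {x}"
| "regs_of (Write a e f) = {}"
| "regs_of (Seq c d) = regs_of c \<union> regs_of d"
| "regs_of (If b c d) = regs_of c \<union> regs_of d"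
| "regs_of (While b c) = regs_of c"

fun arrs_of :: "com \<Rightarrow> string set" where
  "arrs_of Skip = {}"
| "arrs_of (Assign x e) = {}"
| "arrs_of (Write a e f) = {a}"
| "arrs_of (Seq c d) = arrs_of c \<union> arrs_of d"
| "arrs_of (If b c d) = arrs_of c \<union> arrs_of d"
| "arrs_of (While b c) = arrs_of c"

text \<open>A syntactic frame condition. With \<open>sameD\<close> as rewrite rules, invariants have
  to mention only what a loop body really changes.\<close>

definition same :: "com \<Rightarrow> state \<Rightarrow> state \<Rightarrow> bool" where
  "same c s s' \<longleftrightarrow> (\<forall>x. x \<notin> regs_of c \<longrightarrow> reg s' x = reg s x) \<and>
    (\<forall>a. a \<notin> arrs_of c \<longrightarrow> arr s' a = arr s a)"

lemma sameD:
  "same c s s' \<Longrightarrow> x \<notin> regs_of c \<Longrightarrow> reg s' x = reg s x"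
  "same c s s' \<Longrightarrow> a \<notin> arrs_of c \<Longrightarrow> arr s' a = arr s a"
  by (auto simp: same_def)

lemma exec_same: "exec w c s t s' \<Longrightarrow> same c s s'"
  by (induction rule: exec.induct) (auto simp: same_def)

text \<open>Total correctness with a bound \<open>b\<close> on the number of loop iterations, for words that are as
  long as the computation needs.\<close>

definition wp :: "com \<Rightarrow> nat \<Rightarrow> (state \<Rightarrow> bool) \<Rightarrow> state \<Rightarrow> bool" where
  "wp c b Q s \<longleftrightarrow> (\<exists>w t s'. exec w c s t s' \<and> t \<le> unit_cost c * (b + 1) \<and> Q s')"

lemma wp_conseq:
  assumes "wp c b Q s" "b \<le> b'" "\<And>s'. Q s' \<Longrightarrow> same c s s' \<Longrightarrow> Q' s'"
  shows "wp c b' Q' s"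
proof -
  have "unit_cost c * (b + 1) \<le> unit_cost c * (b' + 1)" using assms(2) by simp
  then show ?thesis using assms(1,3) unfolding wp_def by (meson exec_same le_trans)
qed

lemma ex_afits: "\<exists>w. afits w e s"
proof -
  have big: "\<exists>w. x < 2 ^ w" for x :: nat using less_exp by blast
  have conj: "\<exists>w. P w \<and> Q w" if "\<exists>w. P w" "\<exists>w. Q w"
    "\<And>w w'. w \<le> w' \<Longrightarrow> P w \<Longrightarrow> P w'" "\<And>w w'. w \<le> w' \<Longrightarrow> Q w \<Longrightarrow> Q w'" for P Q :: "nat \<Rightarrow> bool"
    using that by (metis nle_le)
  have up: "x < 2 ^ w'" if "w \<le> w'" "x < 2 ^ w" for x w w' :: nat
    using that by (meson less_le_trans one_le_numeral power_increasing)
  show ?thesis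
  proof (induction e)
    case (Read a e)
    then show ?case unfolding afits.simps
      by (intro conj) (auto intro: big afits_mono up)
  next
    case (Plus e f)
    then show ?case unfolding afits.simps
      by (intro conj) (auto intro: big afits_mono up)
  next
    case (Minus e f)
    then show ?case unfolding afits.simps
      by (intro conj) (auto intro: big afits_mono up)
  next
    case (Times e f)
    then show ?case unfolding afits.simps
      by (intro conj) (auto intro: big afits_mono up)
  qed (auto intro: big)
qed

lemma ex_bfits: "\<exists>w. bfits w b s"
proof -
  have two: "\<exists>w. afits w e s \<and> afits w f s" for e f
    using ex_afits[of e s] ex_afits[of f s] by (metis afits_mono nle_le)
  show ?thesis
  proof (induction b)
    case (Conj b c)
    then show ?case by (metis bfits.simps(4) bfits_mono nle_le)
  qed (use two in auto)
qed

lemma wp_Skip: "Q s \<Longrightarrow> wp Skip b Q s"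
  by (auto simp: wp_def intro!: exI exec.intros)

lemma wp_Assign: "Q (s\<lparr>reg := (reg s)(x := aval e s)\<rparr>) \<Longrightarrow> wp (Assign x e) b Q s"
  using ex_afits[of e s] unfolding wp_def by (fastforce intro: exec.intros)

lemma wp_Write:
  "Q (s\<lparr>arr := (arr s)(a := (arr s a)(aval e s := aval f s))\<rparr>) \<Longrightarrow> wp (Write a e f) b Q s"
proof -
  assume Q: "Q (s\<lparr>arr := (arr s)(a := (arr s a)(aval e s := aval f s))\<rparr>)"
  obtain w where "afits w e s" "afits w f s"
    using ex_afits[of e s] ex_afits[of f s] by (metis afits_mono nle_le)
  then show ?thesis using Q unfolding wp_def by (fastforce intro: exec.intros)
qed

lemma wp_Seq:
  assumes "wp c1 b1 Q1 s" "b1 + b2 \<le> b"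
    "\<And>s1. Q1 s1 \<Longrightarrow> same c1 s s1 \<Longrightarrow> wp c2 b2 Q s1"
  shows "wp (Seq c1 c2) b Q s"
proof -
  obtain w1 t1 s1 where 1: "exec w1 c1 s t1 s1" "t1 \<le> unit_cost c1 * (b1 + 1)" "Q1 s1"
    using assms(1) by (auto simp: wp_def)
  then obtain w2 t2 s2 where 2: "exec w2 c2 s1 t2 s2" "t2 \<le> unit_cost c2 * (b2 + 1)" "Q s2"
    using assms(3)[OF 1(3) exec_same[OF 1(1)]] by (auto simp: wp_def)
  have "exec (max w1 w2) (Seq c1 c2) s (t1 + t2) s2"
    by (rule exec.Seq[OF exec_mono[OF max.cobounded1 1(1)] exec_mono[OF max.cobounded2 2(1)]])
  moreover have "t1 \<le> unit_cost c1 * (b + 1)" "t2 \<le> unit_cost c2 * (b + 1)"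
    using assms(2) by (auto intro!: le_trans[OF 1(2)] le_trans[OF 2(2)] mult_le_mono2)
  then have "t1 + t2 \<le> unit_cost (Seq c1 c2) * (b + 1)"
    by (simp add: algebra_simps)
  ultimately show ?thesis using 2(3) unfolding wp_def by blast
qed

lemma wp_If:
  assumes "bval d s \<Longrightarrow> wp c1 b Q s" "\<not> bval d s \<Longrightarrow> wp c2 b Q s"
  shows "wp (If d c1 c2) b Q s"
proof (cases "bval d s")
  case True
  then obtain w1 t1 s1 where 1: "exec w1 c1 s t1 s1" "t1 \<le> unit_cost c1 * (b + 1)" "Q s1"
    using assms(1) by (auto simp: wp_def)
  obtain w2 where "bfits w2 d s" using ex_bfits by blast
  then have "exec (max w1 w2) (If d c1 c2) s (bcost d + 1 + t1) s1"
    using 1 True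
    by (intro exec.IfTrue bfits_mono[OF max.cobounded2] exec_mono[OF max.cobounded1])
  moreover have "bcost d + 1 + t1 \<le> unit_cost (If d c1 c2) * (b + 1)"
    using 1(2) by (simp add: algebra_simps)
  ultimately show ?thesis using 1(3) unfolding wp_def by blast
next
  case False
  then obtain w1 t1 s1 where 1: "exec w1 c2 s t1 s1" "t1 \<le> unit_cost c2 * (b + 1)" "Q s1"
    using assms(2) by (auto simp: wp_def)
  obtain w2 where "bfits w2 d s" using ex_bfits by blast
  then have "exec (max w1 w2) (If d c1 c2) s (bcost d + 1 + t1) s1"
    using 1 False
    by (intro exec.IfFalse bfits_mono[OF max.cobounded2] exec_mono[OF max.cobounded1])
  moreover have "bcost d + 1 + t1 \<le> unit_cost (If d c1 c2) * (b + 1)"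
    using 1(2) by (simp add: algebra_simps)
  ultimately show ?thesis using 1(3) unfolding wp_def by blast
qed

text \<open>The potential \<open>\<phi>\<close> of a ghost state \<open>g\<close> pays for all remaining iterations.\<close>

lemma wp_While:
  assumes step: "\<And>g s. I g s \<Longrightarrow> same c s0 s \<Longrightarrow> bval d s \<Longrightarrow>
      \<exists>b. wp c b (\<lambda>s'. \<exists>g'. I g' s' \<and> \<phi> g' + b + 1 \<le> \<phi> g) s"
    and exit: "\<And>g s. I g s \<Longrightarrow> same c s0 s \<Longrightarrow> \<not> bval d s \<Longrightarrow> Q s"
    and init: "I g s0" "\<phi> g \<le> b0"
  shows "wp (While d c) b0 Q s0"
proof -
  have "wp (While d c) (\<phi> g) Q s" if "I g s" "same c s0 s" for s
    using that
  proof (induction "\<phi> g" arbitrary: g s rule: less_induct)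
    case less
    obtain w2 where w2: "bfits w2 d s" using ex_bfits by blast
    show ?case
    proof (cases "bval d s")
      case False
      then have "exec w2 (While d c) s (bcost d + 1) s" using w2 by (intro exec.WhileFalse)
      moreover have "bcost d + 1 \<le> unit_cost (While d c) * (\<phi> g + 1)" by simp
      ultimately show ?thesis using exit less.prems False unfolding wp_def by blast
    next
      case True
      then obtain b w1 t1 s1 g' where 1: "exec w1 c s t1 s1" "t1 \<le> unit_cost c * (b + 1)"
        "I g' s1" "\<phi> g' + b + 1 \<le> \<phi> g"
        using step[OF less.prems] by (auto simp: wp_def)
      have "same c s0 s1" using less.prems(2) exec_same[OF 1(1)] by (simp add: same_def)
      then obtain w3 t3 s3 where 3: "exec w3 (While d c) s1 t3 s3"
        "t3 \<le> unit_cost (While d c) * (\<phi> g' + 1)" "Q s3"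
        using less.hyps[OF _ 1(3)] 1(4) by (auto simp: wp_def)
      have le: "w1 \<le> max w1 (max w2 w3)" "w2 \<le> max w1 (max w2 w3)" "w3 \<le> max w1 (max w2 w3)"
        by auto
      have "exec (max w1 (max w2 w3)) (While d c) s (bcost d + 1 + t1 + t3) s3"
        using bfits_mono[OF le(2) w2] True exec_mono[OF le(1) 1(1)] exec_mono[OF le(3) 3(1)]
        by (rule exec.intros)
      \<comment> \<open>The iteration counts once itself and \<open>b\<close> times for loops in its
        body. The drop of the potential by \<open>b + 1\<close> pays for body and test together,
        since the unit cost of the loop contains both.\<close>
      moreover have "bcost d + 1 + t1 + t3 \<le> unit_cost (While d c) * (\<phi> g + 1)"
      proof -
        have "bcost d + 1 + t1 + t3 \<le> (bcost d + 1 + unit_cost c) * (b + 1) + t3"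
          using 1(2) by (simp add: algebra_simps)
        also have "\<dots> \<le> unit_cost (While d c) * (b + 1) + unit_cost (While d c) * (\<phi> g' + 1)"
          using 3(2) by simp
        also have "\<dots> = unit_cost (While d c) * (\<phi> g' + b + 1 + 1)"
          by (simp add: algebra_simps)
        also have "\<dots> \<le> unit_cost (While d c) * (\<phi> g + 1)"
          using 1(4) by (intro mult_le_mono2) auto
        finally show ?thesis .
      qed
      ultimately show ?thesis using 3(3) unfolding wp_def by blast
    qed
  qed
  then have "wp (While d c) (\<phi> g) Q s0" using init by (simp add: same_def)
  then show ?thesis using init(2) by (rule wp_conseq) auto
qed

text \<open>\<open>f j\<close> counts the iterations inside round \<open>j\<close>, and the added
  \<open>1\<close> is the round itself; the potential is the cost of the rounds still to
  come.\<close>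

lemma wp_For:
  fixes N :: nat
  assumes init: "I 0 s0" "(\<Sum>j<N. f j + 1) \<le> b0"
    and step: "\<And>j s. j < N \<Longrightarrow> I j s \<Longrightarrow> same c s0 s \<Longrightarrow>
      bval d s \<and> wp c (f j) (I (Suc j)) s"
    and exit: "\<And>s. I N s \<Longrightarrow> same c s0 s \<Longrightarrow> \<not> bval d s \<and> Q s"
  shows "wp (While d c) b0 Q s0"
proof (rule wp_While[where I = "\<lambda>j s. j \<le> N \<and> I j s" and \<phi> = "\<lambda>j. \<Sum>i=j..<N. f i + 1"])
  fix j s assume 1: "j \<le> N \<and> I j s" "same c s0 s" "bval d s"
  then have "j < N" using exit by (metis le_eq_less_or_eq)
  then have "wp c (f j) (I (Suc j)) s" using 1 step by blast
  moreover have "(\<Sum>i=j..<N. f i + 1) = f j + 1 + (\<Sum>i=Suc j..<N. f i + 1)"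
    using \<open>j < N\<close> by (rule sum.atLeast_Suc_lessThan)
  ultimately have "wp c (f j) (\<lambda>s'. \<exists>g'. (g' \<le> N \<and> I g' s') \<and>
      (\<Sum>i=g'..<N. f i + 1) + f j + 1 \<le> (\<Sum>i=j..<N. f i + 1)) s"
    using \<open>j < N\<close> by (elim wp_conseq) (auto intro!: exI[of _ "Suc j"])
  then show "\<exists>b. wp c b (\<lambda>s'. \<exists>g'. (g' \<le> N \<and> I g' s') \<and>
      (\<Sum>i=g'..<N. f i + 1) + b + 1 \<le> (\<Sum>i=j..<N. f i + 1)) s" by blast
next
  fix j s assume "j \<le> N \<and> I j s" "same c s0 s" "\<not> bval d s"
  then show "Q s" using step exit by (metis le_eq_less_or_eq)
qed (use init in \<open>auto simp: lessThan_atLeast0\<close>)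

section \<open>Symbolic execution of straight-line code\<close>

fun loopfree :: "com \<Rightarrow> bool" where
  "loopfree (Seq c d) \<longleftrightarrow> loopfree c \<and> loopfree d"
| "loopfree (If b c d) \<longleftrightarrow> loopfree c \<and> loopfree d"
| "loopfree (While b c) \<longleftrightarrow> False"
| "loopfree c \<longleftrightarrow> True"

text \<open>Turns the verification of loop-free code into simplification. The value on a loop is a
  dummy, excluded by \<open>loopfree\<close> in \<open>wp_loopfree\<close>.\<close>

fun eff :: "com \<Rightarrow> state \<Rightarrow> state" where
  "eff Skip s = s"
| "eff (Assign x e) s = s\<lparr>reg := (reg s)(x := aval e s)\<rparr>"
| "eff (Write a e f) s = s\<lparr>arr := (arr s)(a := (arr s a)(aval e s := aval f s))\<rparr>"
| "eff (Seq c d) s = eff d (eff c s)"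
| "eff (If b c d) s = (if bval b s then eff c s else eff d s)"
| "eff (While b c) s = s"

lemma wp_loopfree: "loopfree c \<Longrightarrow> Q (eff c s) \<Longrightarrow> wp c b Q s"
proof (induction c arbitrary: Q s b)
  case (Seq c d)
  show ?case using Seq
    by (intro wp_Seq[of c 0 "\<lambda>s1. Q (eff d s1)" s b]) simp_all
next
  case (If d c1 c2)
  then show ?case by (intro wp_If) auto
qed (auto intro: wp_Skip wp_Assign wp_Write)

fun seq :: "com list \<Rightarrow> com" where
  "seq [] = Skip"
| "seq [c] = c"
| "seq (c # cs) = Seq c (seq cs)"

section \<open>Linked lists\<close>

text \<open>All lists live in one heap: cell \<open>p\<close> has the entry \<open>cv p\<close> and the successor \<open>cn p\<close>, \<open>0\<close> is the
  empty list, and the cells below \<open>fp\<close> are in use. Cells are never overwritten, so lists may share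
  their tails.\<close>

fun islist :: "(nat \<Rightarrow> nat) \<Rightarrow> (nat \<Rightarrow> nat) \<Rightarrow> nat \<Rightarrow> nat \<Rightarrow> nat list \<Rightarrow> bool" where
  "islist V N b p [] \<longleftrightarrow> p = 0"
| "islist V N b p (x # xs) \<longleftrightarrow> 0 < p \<and> p < b \<and> V p = x \<and> islist V N b (N p) xs"

abbreviation lst :: "state \<Rightarrow> nat \<Rightarrow> nat list \<Rightarrow> bool" where
  "lst s \<equiv> islist (arr s ''cv'') (arr s ''cn'') (reg s ''fp'')"

lemma islist_ext:
  assumes "islist V N b p xs" "b \<le> b'" "\<And>c. c < b \<Longrightarrow> V' c = V c \<and> N' c = N c"
  shows "islist V' N' b' p xs"
  using assms(1) by (induction xs arbitrary: p) (use assms(2,3) in auto)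

lemma islist_fresh:
  "islist V N b p xs \<Longrightarrow> islist (V(b := x)) (N(b := y)) (Suc b) p xs"
  by (erule islist_ext) auto

text \<open>Heap extension: by \<open>lst_hext\<close>, all lists built earlier survive later
  allocations.\<close>

definition hext :: "state \<Rightarrow> state \<Rightarrow> bool" where
  "hext s s' \<longleftrightarrow> reg s ''fp'' \<le> reg s' ''fp'' \<and>
    (\<forall>c<reg s ''fp''. arr s' ''cv'' c = arr s ''cv'' c \<and> arr s' ''cn'' c = arr s ''cn'' c)"

lemma lst_hext: "hext s s' \<Longrightarrow> lst s p xs \<Longrightarrow> lst s' p xs"
  by (erule islist_ext) (auto simp: hext_def)

definition inc :: "string \<Rightarrow> com" where
  "inc x = Assign x (Plus (Reg x) (Const 1))"

definition push :: "aexp \<Rightarrow> string \<Rightarrow> com" where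
  "push e p = seq [Write ''cv'' (Reg ''fp'') e, Write ''cn'' (Reg ''fp'') (Reg p),
     Assign p (Reg ''fp''), inc ''fp'']"

definition while_list :: "string \<Rightarrow> com \<Rightarrow> com" where
  "while_list p c = While (Neg (Equal (Reg p) (Const 0))) c"

definition while_less :: "string \<Rightarrow> string \<Rightarrow> com \<Rightarrow> com" where
  "while_less i k c = While (Less (Reg i) (Reg k)) c"

text \<open>The body has to re-establish the remaining list because it may allocate cells itself, as
  \<open>scan\<close> does while it walks over an antichain.\<close>

lemma wp_while_list:
  assumes init: "lst s0 (reg s0 p) xs" "I 0 s0" "(\<Sum>j<length xs. f j + 1) \<le> b0"
    and step: "\<And>j s. j < length xs \<Longrightarrow> I j s \<Longrightarrow> same c s0 s \<Longrightarrow> 0 < reg s p \<Longrightarrow>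
      reg s p < reg s ''fp'' \<Longrightarrow> arr s ''cv'' (reg s p) = xs ! j \<Longrightarrow>
      lst s (arr s ''cn'' (reg s p)) (drop (Suc j) xs) \<Longrightarrow>
      wp c (f j) (\<lambda>s'. I (Suc j) s' \<and> lst s' (reg s' p) (drop (Suc j) xs)) s"
    and exit: "\<And>s. I (length xs) s \<Longrightarrow> same c s0 s \<Longrightarrow> Q s"
  shows "wp (while_list p c) b0 Q s0"
  unfolding while_list_def
proof (rule wp_For[where N = "length xs" and f = f
      and I = "\<lambda>j s. I j s \<and> lst s (reg s p) (drop j xs)"])
  fix j s assume "j < length xs" "I j s \<and> lst s (reg s p) (drop j xs)" "same c s0 s"
  then show "bval (Neg (Equal (Reg p) (Const 0))) s \<and>
      wp c (f j) (\<lambda>s'. I (Suc j) s' \<and> lst s' (reg s' p) (drop (Suc j) xs)) s"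
    using step[of j s] by (auto simp: Cons_nth_drop_Suc[symmetric])
qed (use init exit in auto)

lemma wp_while_less:
  assumes init: "reg s0 i = 0" "reg s0 k = N" "I 0 s0" "(\<Sum>j<N. f j + 1) \<le> b0"
    and step: "\<And>j s. j < N \<Longrightarrow> I j s \<Longrightarrow> same c s0 s \<Longrightarrow> reg s i = j \<Longrightarrow>
      wp c (f j) (\<lambda>s'. I (Suc j) s' \<and> reg s' i = Suc j) s"
    and exit: "\<And>s. I N s \<Longrightarrow> same c s0 s \<Longrightarrow> Q s"
    and k: "k \<notin> regs_of c"
  shows "wp (while_less i k c) b0 Q s0"
  unfolding while_less_def
proof (rule wp_For[where N = N and f = f and I = "\<lambda>j s. I j s \<and> reg s i = j"])
  fix j s assume "j < N" "I j s \<and> reg s i = j" "same c s0 s"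
  then show "bval (Less (Reg i) (Reg k)) s \<and>
      wp c (f j) (\<lambda>s'. I (Suc j) s' \<and> reg s' i = Suc j) s"
    using step[of j s] init sameD(1)[of c s0 s k] k by auto
qed (use init exit k sameD(1)[of c s0 _ k] in auto)

lemma wp_while_list_Seq:
  assumes "lst s0 (reg s0 p) xs" "I 0 s0" "(\<Sum>j<length xs. f j + 1) + b1 \<le> b0"
    and "\<And>j s. j < length xs \<Longrightarrow> I j s \<Longrightarrow> same c s0 s \<Longrightarrow> 0 < reg s p \<Longrightarrow>
      reg s p < reg s ''fp'' \<Longrightarrow> arr s ''cv'' (reg s p) = xs ! j \<Longrightarrow>
      lst s (arr s ''cn'' (reg s p)) (drop (Suc j) xs) \<Longrightarrow>
      wp c (f j) (\<lambda>s'. I (Suc j) s' \<and> lst s' (reg s' p) (drop (Suc j) xs)) s"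
    and "\<And>s. I (length xs) s \<Longrightarrow> same c s0 s \<Longrightarrow> wp d b1 Q s"
  shows "wp (Seq (while_list p c) d) b0 Q s0"
proof (rule wp_Seq)
  show "wp (while_list p c) (\<Sum>j<length xs. f j + 1)
      (\<lambda>s. I (length xs) s \<and> same c s0 s) s0"
    using assms by (intro wp_while_list[where xs = xs and I = I and f = f]) auto
  show "(\<Sum>j<length xs. f j + 1) + b1 \<le> b0" by fact
  show "wp d b1 Q s" if "I (length xs) s \<and> same c s0 s" for s using that assms(5) by blast
qed

lemma wp_while_less_Seq:
  assumes "reg s0 i = 0" "reg s0 k = N" "I 0 s0" "(\<Sum>j<N. f j + 1) + b1 \<le> b0"
    and "\<And>j s. j < N \<Longrightarrow> I j s \<Longrightarrow> same c s0 s \<Longrightarrow> reg s i = j \<Longrightarrow>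
      wp c (f j) (\<lambda>s'. I (Suc j) s' \<and> reg s' i = Suc j) s"
    and "\<And>s. I N s \<Longrightarrow> same c s0 s \<Longrightarrow> wp d b1 Q s"
    and "k \<notin> regs_of c"
  shows "wp (Seq (while_less i k c) d) b0 Q s0"
proof (rule wp_Seq)
  show "wp (while_less i k c) (\<Sum>j<N. f j + 1) (\<lambda>s. I N s \<and> same c s0 s) s0"
    using assms by (intro wp_while_less[where N = N and I = I and f = f]) auto
  show "(\<Sum>j<N. f j + 1) + b1 \<le> b0" by fact
  show "wp d b1 Q s" if "I N s \<and> same c s0 s" for s using that assms(6) by blast
qed

lemma regs_arrs_basic [simp]:
  "regs_of (inc x) = {x}" "arrs_of (inc x) = {}"
  "regs_of (push e p) = {p, ''fp''}" "arrs_of (push e p) = {''cv'', ''cn''}"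
  "regs_of (while_list p c) = regs_of c" "arrs_of (while_list p c) = arrs_of c"
  "regs_of (while_less i k c) = regs_of c" "arrs_of (while_less i k c) = arrs_of c"
  "loopfree (inc x)" "loopfree (push e p)"
  by (auto simp: inc_def push_def while_list_def while_less_def)

lemma eff_inc [simp]: "eff (inc x) s = s\<lparr>reg := (reg s)(x := Suc (reg s x))\<rparr>"
  by (simp add: inc_def)

lemma eff_push [simp]:
  "p \<noteq> ''fp'' \<Longrightarrow> eff (push (Reg x) p) s =
    s\<lparr>reg := (reg s)(p := reg s ''fp'', ''fp'' := Suc (reg s ''fp'')),
      arr := (arr s)(''cv'' := (arr s ''cv'')(reg s ''fp'' := reg s x),
        ''cn'' := (arr s ''cn'')(reg s ''fp'' := reg s p))\<rparr>"
  by (simp add: push_def)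

lemma wp_pre: "loopfree c1 \<Longrightarrow> wp c2 b Q (eff c1 s) \<Longrightarrow> wp (Seq c1 c2) b Q s"
  by (rule wp_Seq[of c1 0 "\<lambda>s1. s1 = eff c1 s" s b]) (auto intro: wp_loopfree)

lemma wp_post:
  "wp c1 b Q1 s \<Longrightarrow> loopfree c2 \<Longrightarrow> (\<And>s1. Q1 s1 \<Longrightarrow> same c1 s s1 \<Longrightarrow> Q (eff c2 s1)) \<Longrightarrow>
    wp (Seq c1 c2) b Q s"
  by (rule wp_Seq[of c1 b Q1 s 0]) (auto intro: wp_loopfree)

section \<open>Marking the alive vertices that reach the new vertex\<close>

text \<open>The mark for \<open>v\<close> is \<open>v + 1\<close>, so that old marks need not be erased.\<close>

definition mark_row :: com where
  "mark_row = while_list ''r'' (seq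
     [Write ''mk'' (Read ''cv'' (Reg ''r'')) (Plus (Reg ''v'') (Const 1)),
      Assign ''r'' (Read ''cn'' (Reg ''r''))])"

definition mark_all :: com where
  "mark_all = seq [Assign ''p'' (Read ''il'' (Reg ''v'')),
     while_list ''p'' (seq
       [Assign ''r'' (Read ''rl'' (Read ''cv'' (Reg ''p''))), mark_row,
        Assign ''p'' (Read ''cn'' (Reg ''p''))])]"

lemma regs_arrs_mark [simp]:
  "regs_of mark_row = {''r''}" "arrs_of mark_row = {''mk''}"
  "regs_of mark_all = {''p'', ''r''}" "arrs_of mark_all = {''mk''}"
  by (auto simp: mark_row_def mark_all_def)

lemma wp_mark_row:
  assumes "lst s0 (reg s0 ''r'') xs"
  shows "wp mark_row (length xs)
    (\<lambda>s. \<forall>a. arr s ''mk'' a = (if a \<in> set xs then Suc (reg s0 ''v'') else arr s0 ''mk'' a)) s0"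
  unfolding mark_row_def
proof (rule wp_while_list[where xs = xs and f = "\<lambda>_. 0" and I = "\<lambda>j s. \<forall>a. arr s ''mk'' a =
    (if a \<in> set (take j xs) then Suc (reg s0 ''v'') else arr s0 ''mk'' a)"], goal_cases)
  case (4 j s)
  note [simp] = sameD[OF 4(3)]
  show ?case using 4(1,2,6,7) by (intro wp_loopfree) (auto simp: take_Suc_conv_app_nth)
qed (use assms in auto)

lemma wp_mark_all:
  assumes "lst s0 (arr s0 ''il'' (reg s0 ''v'')) us"
    and "\<And>u. u \<in> set us \<Longrightarrow> lst s0 (arr s0 ''rl'' u) (R u)"
  shows "wp mark_all (\<Sum>u\<leftarrow>us. length (R u) + 1)
    (\<lambda>s. \<forall>a. arr s ''mk'' a = (if \<exists>u\<in>set us. a \<in> set (R u) then Suc (reg s0 ''v'')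
      else arr s0 ''mk'' a)) s0"
  unfolding mark_all_def seq.simps
proof (rule wp_pre, simp, rule wp_while_list[where xs = us and f = "\<lambda>j. length (R (us ! j))"
        and I = "\<lambda>j s. \<forall>a. arr s ''mk'' a = (if \<exists>u\<in>set (take j us). a \<in> set (R u)
          then Suc (reg s0 ''v'') else arr s0 ''mk'' a)"], goal_cases)
  case (4 j s)
  note [simp] = sameD[OF 4(3)]
  have l: "lst s0 (arr s0 ''rl'' (us ! j)) (R (us ! j))" using 4(1) assms(2) by simp
  show ?case
  proof (rule wp_pre, simp, rule wp_post, rule wp_mark_row[where xs = "R (us ! j)"], goal_cases)
    case 1
    then show ?case using l 4(6) by simp
  next
    case (3 s4)
    note [simp] = sameD[OF 3(2)]
    show ?case using 4(1,2,6,7) 3(1) by (auto simp: take_Suc_conv_app_nth)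
  qed simp
next
  case 3
  then show ?case by (simp add: sum_list_sum_nth lessThan_atLeast0)
qed (use assms in auto)

section \<open>The reach list of the new vertex and the list of candidates\<close>

definition pairs :: "state \<Rightarrow> string \<Rightarrow> string \<Rightarrow> (nat \<times> nat) list \<Rightarrow> bool" where
  "pairs s a b xs \<longleftrightarrow> (\<forall>i<length xs. arr s a i = fst (xs ! i) \<and> arr s b i = snd (xs ! i))"

text \<open>One pass over an antichain serves two purposes: \<open>h\<close> records whether it
  reaches the new vertex, and its marked members go to the new reach list. A vertex on several
  antichains is pushed several times; the length bound counts it with multiplicity.\<close>

definition scan :: com where
  "scan = while_list ''p'' (seq
     [If (Equal (Read ''mk'' (Read ''cv'' (Reg ''p''))) (Plus (Reg ''v'') (Const 1)))
        (seq [Assign ''x'' (Read ''cv'' (Reg ''p'')), Assign ''h'' (Const 1), push (Reg ''x'') ''rp''])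
        Skip,
      Assign ''p'' (Read ''cn'' (Reg ''p''))])"

definition collect_body :: com where
  "collect_body = seq
     [Assign ''h'' (Const 0), Assign ''p'' (Read ''ce'' (Plus (Reg ''fb'') (Reg ''j''))), scan,
      seq [Write ''hit'' (Reg ''j'') (Reg ''h''),
      Write ''or'' (Reg ''cs'') (Reg ''j''), Write ''nw'' (Reg ''cs'') (Const 0), inc ''cs'',
      If (Equal (Reg ''h'') (Const 0))
        (seq [Write ''or'' (Reg ''cs'') (Reg ''j''), Write ''nw'' (Reg ''cs'') (Const 1), inc ''cs''])
        Skip,
      inc ''j'']]"

text \<open>The list of \<open>v\<close> begins with \<open>v\<close> itself, which reaches itself
  and may belong to the new antichains.\<close>

definition collect :: com where
  "collect = seq [Assign ''rp'' (Const 0), push (Reg ''v'') ''rp'', Assign ''cs'' (Const 0),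
     Assign ''j'' (Const 0), while_less ''j'' ''fs'' collect_body,
     Write ''rl'' (Reg ''v'') (Reg ''rp'')]"

lemma regs_arrs_collect [simp]:
  "regs_of scan = {''x'', ''h'', ''rp'', ''fp'', ''p''}" "arrs_of scan = {''cv'', ''cn''}"
  "regs_of collect_body = {''x'', ''h'', ''rp'', ''fp'', ''p'', ''cs'', ''j''}"
  "arrs_of collect_body = {''cv'', ''cn'', ''hit'', ''or'', ''nw''}"
  "regs_of collect = {''x'', ''h'', ''rp'', ''fp'', ''p'', ''cs'', ''j''}"
  "arrs_of collect = {''cv'', ''cn'', ''hit'', ''or'', ''nw'', ''rl''}"
  by (auto simp: scan_def collect_body_def collect_def)

lemma wp_scan:
  assumes "lst s0 (reg s0 ''p'') xs" "lst s0 (reg s0 ''rp'') ys" "0 < reg s0 ''fp''"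
    and M: "\<And>x. M x \<longleftrightarrow> arr s0 ''mk'' x = Suc (reg s0 ''v'')"
  shows "wp scan (length xs) (\<lambda>s. lst s (reg s ''rp'') (rev (filter M xs) @ ys) \<and> hext s0 s \<and>
    0 < reg s ''fp'' \<and> reg s ''h'' = (if \<exists>x\<in>set xs. M x then 1 else reg s0 ''h'')) s0"
  unfolding scan_def
proof (rule wp_while_list[where xs = xs and f = "\<lambda>_. 0" and I = "\<lambda>j s.
    lst s (reg s ''rp'') (rev (filter M (take j xs)) @ ys) \<and> hext s0 s \<and>
    0 < reg s ''fp'' \<and> reg s ''h'' = (if \<exists>x\<in>set (take j xs). M x then 1 else reg s0 ''h'')"], goal_cases)
  case (4 j s)
  note [simp] = sameD[OF 4(3)]
  show ?case using 4(1,2,4-)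
    by (intro wp_loopfree)
      (auto simp: take_Suc_conv_app_nth M hext_def intro!: islist_fresh)
qed (use assms in \<open>auto simp: hext_def\<close>)

text \<open>\<open>(j, 0)\<close> stands for the antichain \<open>Fs ! j\<close> and \<open>(j, 1)\<close> for its extension by the new vertex.\<close>

definition cands_list :: "('a \<Rightarrow> bool) \<Rightarrow> 'a list list \<Rightarrow> nat \<Rightarrow> (nat \<times> nat) list" where
  "cands_list M Fs m =
    concat (map (\<lambda>j. (j, 0) # (if \<exists>x\<in>set (Fs ! j). M x then [] else [(j, 1)])) [0..<m])"

lemma cands_list_Suc:
  "cands_list M Fs (Suc m) =
    cands_list M Fs m @ (m, 0) # (if \<exists>x\<in>set (Fs ! m). M x then [] else [(m, 1)])"
  by (simp add: cands_list_def)

lemma wp_collect: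
  assumes Fs: "reg s0 ''fs'' = length Fs"
      "\<And>j. j < length Fs \<Longrightarrow> lst s0 (arr s0 ''ce'' (reg s0 ''fb'' + j)) (Fs ! j)"
    and fp: "0 < reg s0 ''fp''"
    and M: "\<And>x. M x \<longleftrightarrow> arr s0 ''mk'' x = Suc (reg s0 ''v'')"
  shows "wp collect (\<Sum>A\<leftarrow>Fs. length A + 1) (\<lambda>s.
    (\<exists>p. arr s ''rl'' = (arr s0 ''rl'')(reg s0 ''v'' := p) \<and>
      lst s p (rev (filter M (concat Fs)) @ [reg s0 ''v''])) \<and> hext s0 s \<and> 0 < reg s ''fp'' \<and>
    (\<forall>i<length Fs. arr s ''hit'' i = (if \<exists>x\<in>set (Fs ! i). M x then 1 else 0)) \<and>
    reg s ''cs'' = length (cands_list M Fs (length Fs)) \<and>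
    pairs s ''or'' ''nw'' (cands_list M Fs (length Fs))) s0"
  unfolding collect_def seq.simps
proof ((rule wp_pre, simp)+,
    rule wp_while_less_Seq[where ?b1.0 = 0 and N = "length Fs" and f = "\<lambda>j. length (Fs ! j)" and
      I = "\<lambda>j s. lst s (reg s ''rp'') (rev (filter M (concat (take j Fs))) @ [reg s0 ''v'']) \<and>
        hext s0 s \<and> 0 < reg s ''fp'' \<and>
        (\<forall>i<j. arr s ''hit'' i = (if \<exists>x\<in>set (Fs ! i). M x then 1 else 0)) \<and>
        reg s ''cs'' = length (cands_list M Fs j) \<and>
        pairs s ''or'' ''nw'' (cands_list M Fs j)"], goal_cases)
  case (5 j s)
  note [simp] = sameD[OF 5(3)]
  have l: "lst s (arr s0 ''ce'' (reg s0 ''fb'' + j)) (Fs ! j)"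
    using lst_hext[of s0 s] 5(2) Fs(2)[OF 5(1)] by blast
  show ?case
    unfolding collect_body_def seq.simps
  proof (rule wp_pre, simp, rule wp_pre, simp, rule wp_post,
      rule wp_scan[where xs = "Fs ! j" and M = M
        and ys = "rev (filter M (concat (take j Fs))) @ [reg s0 ''v'']"], goal_cases)
    case (6 s4)
    note [simp] = sameD[OF 6(2)]
    show ?case using 6(1) 5(1,2,4)
      by (auto simp: take_Suc_conv_app_nth hext_def less_Suc_eq pairs_def nth_append
          cands_list_Suc)
  qed (use 5(2,4) l M in auto)
next
  case 1 then show ?case by simp
next
  case 2 then show ?case by (simp add: Fs)
next
  case 3 then show ?case using fp by (auto simp: hext_def pairs_def cands_list_def)
next
  case 4 then show ?case by (simp add: sum_list_sum_nth lessThan_atLeast0)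
next
  case (6 s)
  note [simp] = sameD[OF 6(2)]
  show ?case using 6(1) by (intro wp_loopfree) (auto simp: pairs_def hext_def)
qed simp

section \<open>Updating the undominated antichains\<close>

text \<open>Whether every member of candidate \<open>d\<close> is reached from candidate \<open>c\<close>, cf.
  \<open>up_insert_cases\<close>: the new vertex matters only if it is in \<open>d\<close> but not in \<open>c\<close>.\<close>

definition covers :: "state \<Rightarrow> nat \<times> nat \<Rightarrow> nat \<times> nat \<Rightarrow> bool" where
  "covers s c d \<longleftrightarrow> arr s ''D'' (reg s ''db'' + fst c * reg s ''fs'' + fst d) = 1 \<and>
    \<not> (snd c < snd d \<and> arr s ''hit'' (fst c) = 0)"

text \<open>\<open>d\<close> is the dominating candidate, \<open>c\<close> the one discarded.
  Comparing index pairs instead of sets is sound since different candidates denote different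
  sets.\<close>

definition kill :: "state \<Rightarrow> nat \<times> nat \<Rightarrow> nat \<times> nat \<Rightarrow> bool" where
  "kill s c d \<longleftrightarrow>
    arr s ''sz'' (reg s ''fb'' + fst c) + snd c = arr s ''sz'' (reg s ''fb'' + fst d) + snd d \<and>
    covers s c d \<and> c \<noteq> d"

definition covers_test :: bexp where
  "covers_test = Conj
     (Equal (Read ''D'' (Plus (Plus (Reg ''db'') (Times (Reg ''o'') (Reg ''fs''))) (Reg ''o2'')))
       (Const 1))
     (Neg (Conj (Less (Reg ''b'') (Reg ''b2'')) (Equal (Read ''hit'' (Reg ''o'')) (Const 0))))"

lemma bval_covers_test [simp]:
  "bval covers_test s = covers s (reg s ''o'', reg s ''b'') (reg s ''o2'', reg s ''b2'')"
  by (simp add: covers_test_def covers_def)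

definition kill_test :: bexp where
  "kill_test = Conj
     (Equal (Plus (Read ''sz'' (Plus (Reg ''fb'') (Reg ''o''))) (Reg ''b''))
       (Plus (Read ''sz'' (Plus (Reg ''fb'') (Reg ''o2''))) (Reg ''b2'')))
     (Conj covers_test
       (Neg (Conj (Equal (Reg ''o'') (Reg ''o2'')) (Equal (Reg ''b'') (Reg ''b2'')))))"

lemma bval_kill_test [simp]:
  "bval kill_test s = kill s (reg s ''o'', reg s ''b'') (reg s ''o2'', reg s ''b2'')"
  by (simp add: kill_test_def kill_def)

definition prune_inner :: com where
  "prune_inner = seq
     [Assign ''o2'' (Read ''or'' (Reg ''d'')), Assign ''b2'' (Read ''nw'' (Reg ''d'')),
      If kill_test (Assign ''dead'' (Const 1)) Skip, inc ''d'']"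

definition prune_body :: com where
  "prune_body = seq
     [Assign ''o'' (Read ''or'' (Reg ''c'')), Assign ''b'' (Read ''nw'' (Reg ''c'')),
      Assign ''dead'' (Const 0), Assign ''d'' (Const 0), while_less ''d'' ''cs'' prune_inner,
      seq [If (Equal (Reg ''dead'') (Const 0))
        (seq [Write ''ko'' (Reg ''nk'') (Reg ''o''), Write ''kw'' (Reg ''nk'') (Reg ''b''),
          inc ''nk'']) Skip,
      inc ''c'']]"

definition prune :: com where
  "prune = seq
     [Assign ''nk'' (Const 0), Assign ''c'' (Const 0), while_less ''c'' ''cs'' prune_body]"

lemma regs_arrs_prune [simp]:
  "regs_of prune_inner = {''o2'', ''b2'', ''dead'', ''d''}" "arrs_of prune_inner = {}"
  "regs_of prune_body = {''o'', ''b'', ''o2'', ''b2'', ''dead'', ''d'', ''c'', ''nk''}"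
  "arrs_of prune_body = {''ko'', ''kw''}"
  "regs_of prune = {''o'', ''b'', ''o2'', ''b2'', ''dead'', ''d'', ''c'', ''nk''}"
  "arrs_of prune = {''ko'', ''kw''}"
  by (auto simp: prune_inner_def prune_body_def prune_def)

lemma covers_cong:
  "arr s ''D'' = arr s' ''D'' \<Longrightarrow> arr s ''hit'' = arr s' ''hit'' \<Longrightarrow> reg s ''db'' = reg s' ''db'' \<Longrightarrow>
    reg s ''fs'' = reg s' ''fs'' \<Longrightarrow> covers s = covers s'"
  by (simp add: covers_def fun_eq_iff)

lemma kill_cong:
  "arr s ''D'' = arr s' ''D'' \<Longrightarrow> arr s ''hit'' = arr s' ''hit'' \<Longrightarrow> reg s ''db'' = reg s' ''db'' \<Longrightarrow>
    reg s ''fs'' = reg s' ''fs'' \<Longrightarrow> arr s ''sz'' = arr s' ''sz'' \<Longrightarrow> reg s ''fb'' = reg s' ''fb'' \<Longrightarrow>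
    kill s = kill s'"
  using covers_cong[of s s'] by (simp add: kill_def fun_eq_iff)

lemma wp_prune:
  assumes Cs: "reg s0 ''cs'' = length Cs" "pairs s0 ''or'' ''nw'' Cs"
  defines "ks \<equiv> filter (\<lambda>c. \<not> (\<exists>d\<in>set Cs. kill s0 c d)) Cs"
  shows "wp prune (length Cs * (length Cs + 1))
    (\<lambda>s. reg s ''nk'' = length ks \<and> pairs s ''ko'' ''kw'' ks) s0"
  unfolding prune_def seq.simps
proof ((rule wp_pre, simp)+, rule wp_while_less[where N = "length Cs" and f = "\<lambda>_. length Cs" and
      I = "\<lambda>j s. reg s ''nk'' = length (filter (\<lambda>c. \<not> (\<exists>d\<in>set Cs. kill s0 c d)) (take j Cs)) \<and>
        pairs s ''ko'' ''kw'' (filter (\<lambda>c. \<not> (\<exists>d\<in>set Cs. kill s0 c d)) (take j Cs))"], goal_cases)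
  case (5 j s)
  note [simp] = sameD[OF 5(3)]
  have c: "(arr s0 ''or'' j, arr s0 ''nw'' j) = Cs ! j" using Cs 5(1) by (auto simp: pairs_def)
  show ?case
    unfolding prune_body_def seq.simps
  proof ((rule wp_pre, simp)+, rule wp_while_less_Seq[where N = "length Cs" and f = "\<lambda>_. 0"
        and ?b1.0 = 0 and I = "\<lambda>i s. reg s ''dead'' =
          (if \<exists>d\<in>set (take i Cs). kill s0 (Cs ! j) d then 1 else 0)"], goal_cases)
    case (5 i s')
    note [simp] = sameD[OF 5(3)]
    have d: "(arr s0 ''or'' i, arr s0 ''nw'' i) = Cs ! i" using Cs 5(1) by (auto simp: pairs_def)
    have [simp]: "kill (s'\<lparr>reg := (reg s')(''o2'' := x, ''b2'' := y)\<rparr>) = kill s0" for x y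
      by (rule kill_cong) simp_all
    show ?case unfolding prune_inner_def
      using 5(1,2,4) c d \<open>reg s ''c'' = j\<close> by (intro wp_loopfree) (auto simp: take_Suc_conv_app_nth)
  next
    case (6 s')
    note [simp] = sameD[OF 6(2)]
    have "fst (Cs ! j) = arr s0 ''or'' j" "snd (Cs ! j) = arr s0 ''nw'' j"
      using c by (metis fst_conv, metis snd_conv)
    then show ?case using 6(1) 5(1,2,4)
      by (intro wp_loopfree) (auto simp: take_Suc_conv_app_nth pairs_def nth_append less_Suc_eq)
  qed (use Cs in simp_all)
qed (use Cs in \<open>auto simp: pairs_def ks_def\<close>)

definition ext :: "'a \<Rightarrow> 'a list list \<Rightarrow> nat \<times> nat \<Rightarrow> 'a list" where
  "ext v Fs c = (if snd c = 0 then Fs ! fst c else v # Fs ! fst c)"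

text \<open>Antichain \<open>j\<close> and its size are at \<open>fb + j\<close> in the arrays \<open>ce\<close> and \<open>sz\<close>; row \<open>i\<close> of the domination
  matrix starts at \<open>db + i * fs\<close> in \<open>D\<close>. Each new generation is written behind the old
  one, at \<open>ft\<close> and \<open>dt\<close>, while the latter is still being read.\<close>

definition frontier :: "state \<Rightarrow> nat list list \<Rightarrow> bool" where
  "frontier s Fs \<longleftrightarrow> reg s ''fs'' = length Fs \<and> reg s ''ft'' = reg s ''fb'' + length Fs \<and>
    reg s ''dt'' = reg s ''db'' + length Fs * length Fs \<and> 0 < reg s ''fp'' \<and>
    (\<forall>j<length Fs. lst s (arr s ''ce'' (reg s ''fb'' + j)) (Fs ! j) \<and>
      arr s ''sz'' (reg s ''fb'' + j) = length (Fs ! j))"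

definition rebuild_inner :: com where
  "rebuild_inner = seq
     [Assign ''o2'' (Read ''ko'' (Reg ''d'')), Assign ''b2'' (Read ''kw'' (Reg ''d'')),
      If covers_test (Write ''D'' (Reg ''dt'') (Const 1)) (Write ''D'' (Reg ''dt'') (Const 0)),
      inc ''dt'', inc ''d'']"

definition rebuild_body :: com where
  "rebuild_body = seq
     [seq [Assign ''o'' (Read ''ko'' (Reg ''c'')), Assign ''b'' (Read ''kw'' (Reg ''c'')),
        Assign ''p'' (Read ''ce'' (Plus (Reg ''fb'') (Reg ''o''))),
        Assign ''z'' (Read ''sz'' (Plus (Reg ''fb'') (Reg ''o''))),
        If (Equal (Reg ''b'') (Const 0)) Skip (seq [push (Reg ''v'') ''p'', inc ''z'']),
        Write ''ce'' (Reg ''ft'') (Reg ''p''), Write ''sz'' (Reg ''ft'') (Reg ''z''),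
        inc ''ft'', Assign ''d'' (Const 0)],
      while_less ''d'' ''nk'' rebuild_inner, inc ''c'']"

definition rebuild :: com where
  "rebuild = seq
     [Assign ''nb'' (Reg ''ft''), Assign ''nd'' (Reg ''dt''), Assign ''c'' (Const 0),
      while_less ''c'' ''nk'' rebuild_body,
      seq [Assign ''fb'' (Reg ''nb''), Assign ''db'' (Reg ''nd''), Assign ''fs'' (Reg ''nk'')]]"

lemma regs_arrs_rebuild [simp]:
  "regs_of rebuild_inner = {''o2'', ''b2'', ''dt'', ''d''}" "arrs_of rebuild_inner = {''D''}"
  "regs_of rebuild_body =
    {''o'', ''b'', ''p'', ''z'', ''fp'', ''ft'', ''o2'', ''b2'', ''dt'', ''d'', ''c''}"
  "arrs_of rebuild_body = {''D'', ''cv'', ''cn'', ''ce'', ''sz''}"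
  "regs_of rebuild = {''o'', ''b'', ''p'', ''z'', ''fp'', ''ft'', ''o2'', ''b2'', ''dt'', ''d'', ''c'',
    ''nb'', ''nd'', ''fb'', ''db'', ''fs''}"
  "arrs_of rebuild = {''D'', ''cv'', ''cn'', ''ce'', ''sz''}"
  by (auto simp: rebuild_inner_def rebuild_body_def rebuild_def)

lemma matrix_index_less: "i < m \<Longrightarrow> j < k \<Longrightarrow> i * k + j < m * (k :: nat)"
proof -
  assume "i < m" "j < k"
  then have "i * k + j < Suc i * k" by simp
  also have "\<dots> \<le> m * k" using \<open>i < m\<close> by (intro mult_le_mono1) simp
  finally show ?thesis .
qed

lemma wp_rebuild:
  fixes Fs ks
  assumes fr: "frontier s0 Fs"
    and ks: "reg s0 ''nk'' = length ks" "pairs s0 ''ko'' ''kw'' ks" "\<And>c. c \<in> set ks \<Longrightarrow> fst c < length Fs"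
  defines "N \<equiv> length ks"
  shows "wp rebuild (N * (N + 1)) (\<lambda>s. frontier s (map (ext (reg s0 ''v'') Fs) ks) \<and> hext s0 s \<and>
    (\<forall>i<N. \<forall>j<N. arr s ''D'' (reg s ''db'' + (i * N + j)) = (if covers s0 (ks ! i) (ks ! j) then 1 else 0))) s0"
  unfolding rebuild_def seq.simps
proof ((rule wp_pre, simp)+, rule wp_while_less_Seq[where N = N and f = "\<lambda>_. N" and ?b1.0 = 0 and
      I = "\<lambda>c s. hext s0 s \<and> 0 < reg s ''fp'' \<and>
       reg s ''ft'' = reg s0 ''ft'' + c \<and> reg s ''dt'' = reg s0 ''dt'' + c * N \<and>
       (\<forall>i<reg s0 ''ft''. arr s ''ce'' i = arr s0 ''ce'' i \<and> arr s ''sz'' i = arr s0 ''sz'' i) \<and>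
       (\<forall>i<reg s0 ''dt''. arr s ''D'' i = arr s0 ''D'' i) \<and>
       (\<forall>i<c. lst s (arr s ''ce'' (reg s0 ''ft'' + i)) (ext (reg s0 ''v'') Fs (ks ! i)) \<and>
         arr s ''sz'' (reg s0 ''ft'' + i) = length (ext (reg s0 ''v'') Fs (ks ! i))) \<and>
       (\<forall>i<c. \<forall>j<N. arr s ''D'' (reg s0 ''dt'' + (i * N + j)) =
         (if covers s0 (ks ! i) (ks ! j) then 1 else 0))"], goal_cases)
  case (5 c s)
  note [simp] = sameD[OF 5(3)]
  have N [simp]: "length ks = N" by (simp add: N_def)
  note c = 5(1) and inv = 5(2) and [simp] = 5(4)
  obtain w b where [simp]: "ks ! c = (w, b)" by fastforce
  have [simp]: "arr s0 ''ko'' c = w" "arr s0 ''kw'' c = b"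
    using ks(2) c by (auto simp: pairs_def)
  have w: "w < length Fs" using ks(3)[of "ks ! c"] c nth_mem[of c ks] by simp
  then have wt: "reg s0 ''fb'' + w < reg s0 ''ft''" using fr by (simp add: frontier_def)
  have lw: "lst s (arr s0 ''ce'' (reg s0 ''fb'' + w)) (Fs ! w)"
    "arr s0 ''sz'' (reg s0 ''fb'' + w) = length (Fs ! w)"
    using w fr lst_hext[of s0 s] inv by (auto simp: frontier_def)
  show ?case
    unfolding rebuild_body_def seq.simps
  proof (rule wp_pre, simp, rule wp_while_less_Seq[where N = N and f = "\<lambda>_. 0" and ?b1.0 = 0 and
      I = "\<lambda>d s'. reg s' ''dt'' = reg s0 ''dt'' + (c * N + d) \<and>
       (\<forall>i<reg s0 ''dt'' + c * N. arr s' ''D'' i = arr s ''D'' i) \<and>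
       (\<forall>j<d. arr s' ''D'' (reg s0 ''dt'' + (c * N + j)) =
         (if covers s0 (ks ! c) (ks ! j) then 1 else 0))"], goal_cases)
    case (5 d s')
    note [simp] = sameD[OF 5(3)] 5(4)
    obtain w2 b2 where [simp]: "ks ! d = (w2, b2)" by fastforce
    have [simp]: "arr s0 ''ko'' d = w2" "arr s0 ''kw'' d = b2"
      using ks(2) 5(1) by (auto simp: pairs_def)
    have w2: "w2 < length Fs" using ks(3)[of "ks ! d"] 5(1) nth_mem[of d ks] by simp
    \<comment> \<open>The entry consulted belongs to the old matrix, which ends at
      \<open>dt\<close>; the writes of the new generation cannot have disturbed it.\<close>
    have ix: "reg s0 ''db'' + w * reg s0 ''fs'' + w2 < reg s0 ''dt''"
      using matrix_index_less[OF w w2] fr by (simp add: frontier_def)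
    have [simp]: "covers (s'\<lparr>reg := (reg s')(''o2'' := x, ''b2'' := y)\<rparr>) (w, b') (w2, b2) =
      covers s0 (w, b') (w2, b2)" for x y b'
      using 5(2) inv ix by (simp add: covers_def)
    show ?case unfolding rebuild_inner_def
      using 5(2) by (intro wp_loopfree) (auto simp: less_Suc_eq)
  next
    case (6 s')
    note [simp] = sameD[OF 6(2)]
    have D: "arr s' ''D'' (reg s0 ''dt'' + (i * N + j)) = (if covers s0 (ks ! i) (ks ! j) then 1 else 0)"
      if "i < Suc c" "j < N" for i j
    proof (cases "i = c")
      case True
      then show ?thesis using 6(1) that by simp
    next
      case False
      then show ?thesis using 6(1) that inv matrix_index_less[of i c j N] by simp
    qed
    show ?case
      using 6(1) inv lw wt D
      by (intro wp_loopfree) (auto simp: hext_def less_Suc_eq ext_def intro!: islist_fresh)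
  next
    case 3
    show ?case using inv by simp
  qed (use ks in simp_all)
next
  case (6 s)
  note [simp] = sameD[OF 6(2)]
  show ?case using 6(1) ks fr by (intro wp_loopfree) (auto simp: frontier_def N_def hext_def)
qed (use fr ks in \<open>auto simp: hext_def frontier_def N_def\<close>)

section \<open>One step of the sweep on lists of antichains\<close>

context porder
begin

text \<open>Distinctness of the sets, not merely of the lists, makes \<open>length Fs\<close> the
  size of \<open>front V\<close> and lets candidates be told apart by their indices.\<close>

definition lists_front :: "'a set \<Rightarrow> 'a list list \<Rightarrow> bool" where
  "lists_front V Fs \<longleftrightarrow>
    distinct (map set Fs) \<and> set ` set Fs = front V \<and> (\<forall>A\<in>set Fs. distinct A)"

lemma lists_front_bounds:
  assumes "lists_front V Fs" "finite V" "\<And>X. X \<subseteq> V \<Longrightarrow> indep X \<Longrightarrow> card X \<le> k"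
  shows "length Fs \<le> 2 ^ k" "\<And>A. A \<in> set Fs \<Longrightarrow> length A \<le> k \<and> set A \<subseteq> V"
proof -
  have "length Fs = card (set (map set Fs))"
    using assms(1) by (metis distinct_card length_map lists_front_def)
  then show "length Fs \<le> 2 ^ k"
    using card_front_le[OF assms(2,3)] assms(1) by (simp add: lists_front_def)
  show "length A \<le> k \<and> set A \<subseteq> V" if "A \<in> set Fs" for A
  proof -
    have "set A \<in> front V" "distinct A" using that assms(1) by (auto simp: lists_front_def)
    then show ?thesis using assms(3)[of "set A"] by (simp add: frontD distinct_card)
  qed
qed

lemma in_cands_list:
  "c \<in> set (cands_list M Fs m) \<longleftrightarrow>
    fst c < m \<and> (snd c = 0 \<or> snd c = 1 \<and> \<not> (\<exists>x\<in>set (Fs ! fst c). M x))"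
  by (cases c) (auto simp: cands_list_def)

lemma distinct_cands_list: "distinct (cands_list M Fs m)"
proof (induction m)
  case (Suc m)
  then show ?case by (auto simp: cands_list_Suc in_cands_list)
qed (simp add: cands_list_def)

lemma length_cands_list: "length (cands_list M Fs m) \<le> 2 * m"
  by (induction m) (auto simp: cands_list_Suc, simp add: cands_list_def)

text \<open>The machine-free content of a step; \<open>M\<close> and \<open>K\<close> stand for the
  marks and the kill test. \<open>M\<close> has to be right only on members of current antichains,
  which is all that the reach lists guarantee.\<close>

lemma lists_front_step:
  fixes Fs :: "'a list list"
  assumes fin: "finite V" and v: "v \<notin> V" "\<And>x. x \<in> V \<Longrightarrow> (v, x) \<notin> r"
    and Fs: "lists_front V Fs"
    and M: "\<And>A a. A \<in> set Fs \<Longrightarrow> a \<in> set A \<Longrightarrow> M a \<longleftrightarrow> (a, v) \<in> r"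
  defines "Cs \<equiv> cands_list M Fs (length Fs)"
  assumes K: "\<And>c d. c \<in> set Cs \<Longrightarrow> d \<in> set Cs \<Longrightarrow> K c d \<longleftrightarrow>
      length (ext v Fs c) = length (ext v Fs d) \<and>
      set (ext v Fs d) \<subseteq> r `` set (ext v Fs c) \<and> c \<noteq> d"
  defines "ks \<equiv> filter (\<lambda>c. \<not> (\<exists>d\<in>set Cs. K c d)) Cs"
  shows "lists_front (insert v V) (map (ext v Fs) ks)"
proof -
  define g where "g c = set (ext v Fs c)" for c
  have Fs_V: "set (Fs ! i) \<subseteq> V" "distinct (Fs ! i)" "set (Fs ! i) \<in> front V" if "i < length Fs" for i
  proof -
    show "set (Fs ! i) \<in> front V" "distinct (Fs ! i)"
      using that Fs nth_mem[of i Fs] unfolding lists_front_def by blast+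
    then show "set (Fs ! i) \<subseteq> V" by (simp add: frontD)
  qed
  have Mv: "(\<exists>x\<in>set (Fs ! i). M x) \<longleftrightarrow> v \<in> r `` set (Fs ! i)" if "i < length Fs" for i
    using M[of "Fs ! i"] that by auto
  have Cs: "c \<in> set Cs \<longleftrightarrow> fst c < length Fs \<and> (snd c = 0 \<or> snd c = 1 \<and> v \<notin> r `` set (Fs ! fst c))" for c
    using Mv[of "fst c"] unfolding Cs_def in_cands_list by blast
  have img: "g ` set Cs = cands V v"
  proof -
    have F: "front V = (\<lambda>i. set (Fs ! i)) ` {..<length Fs}"
    proof -
      have "set Fs = (!) Fs ` {..<length Fs}" by (auto simp: in_set_conv_nth)
      then have "set ` set Fs = (\<lambda>i. set (Fs ! i)) ` {..<length Fs}"
        by (metis (no_types, lifting) image_cong image_image)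
      then show ?thesis using Fs by (simp add: lists_front_def)
    qed
    have "g c \<in> cands V v" if "c \<in> set Cs" for c
      using that Fs_V(3)[of "fst c"] unfolding cands_def by (auto simp: g_def ext_def Cs)
    then have "g ` set Cs \<subseteq> cands V v" by blast
    moreover have "X \<in> g ` set Cs" if X: "X \<in> cands V v" for X
    proof -
      consider i where "i < length Fs" "X = set (Fs ! i)" |
        i where "i < length Fs" "v \<notin> r `` set (Fs ! i)" "X = insert v (set (Fs ! i))"
        using X unfolding cands_def F by blast
      then show ?thesis
      proof cases
        case 1
        then show ?thesis by (intro image_eqI[of _ _ "(i, 0)"]) (auto simp: g_def ext_def Cs)
      next
        case 2
        then show ?thesis by (intro image_eqI[of _ _ "(i, 1)"]) (auto simp: g_def ext_def Cs)
      qed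
    qed
    ultimately show ?thesis by blast
  qed
  have len: "card (g c) = length (ext v Fs c)" "distinct (ext v Fs c)" if "c \<in> set Cs" for c
  proof -
    show "distinct (ext v Fs c)" using that Fs_V(1,2)[of "fst c"] v(1) by (auto simp: ext_def Cs)
    then show "card (g c) = length (ext v Fs c)" by (simp add: g_def distinct_card)
  qed
  \<comment> \<open>Whether \<open>v\<close> occurs in the set determines the second component; what
    remains without \<open>v\<close> determines the index, as the sets in \<open>Fs\<close> are
    distinct.\<close>
  have inj: "inj_on g (set Cs)"
  proof (rule inj_onI)
    fix c d assume cd: "c \<in> set Cs" "d \<in> set Cs" "g c = g d"
    then have lt: "fst c < length Fs" "fst d < length Fs" by (auto simp: Cs)
    then have "v \<notin> set (Fs ! fst c)" "v \<notin> set (Fs ! fst d)" using Fs_V v by blast+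
    then have "snd c = 0 \<longleftrightarrow> snd d = 0" "set (Fs ! fst c) = set (Fs ! fst d)"
      using cd(3) by (auto simp: g_def ext_def split: if_splits)
    then have "snd c = snd d" "map set Fs ! fst c = map set Fs ! fst d"
      using cd lt by (auto simp: Cs)
    moreover have "fst c = fst d"
      using calculation(2) lt Fs nth_eq_iff_index_eq[of "map set Fs" "fst c" "fst d"]
      by (simp add: lists_front_def)
    ultimately show "c = d" by (simp add: prod_eq_iff)
  qed
  have kill: "(\<exists>d\<in>set Cs. K c d) \<longleftrightarrow>
      \<not> (\<forall>Z\<in>g ` set Cs. card Z = card (g c) \<longrightarrow> Z \<subseteq> r `` g c \<longrightarrow> Z = g c)" if c: "c \<in> set Cs" for c
  proof -
    have "K c d \<longleftrightarrow> card (g d) = card (g c) \<and> g d \<subseteq> r `` g c \<and> g d \<noteq> g c" if "d \<in> set Cs" for d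
      using K[OF c that] len(1)[OF c] len(1)[OF that] inj c that
      by (auto simp: inj_on_def g_def[symmetric])
    then have "(\<exists>d\<in>set Cs. K c d) \<longleftrightarrow>
        (\<exists>d\<in>set Cs. card (g d) = card (g c) \<and> g d \<subseteq> r `` g c \<and> g d \<noteq> g c)"
      by (intro bex_cong) simp_all
    then show ?thesis by simp
  qed
  define P where "P X \<longleftrightarrow> (\<forall>Z\<in>g ` set Cs. card Z = card X \<longrightarrow> Z \<subseteq> r `` X \<longrightarrow> Z = X)" for X
  have "set ks = {c \<in> set Cs. P (g c)}"
    unfolding ks_def set_filter P_def by (intro Collect_cong conj_cong refl) (simp only: kill not_not)
  then have "g ` set ks = {X \<in> g ` set Cs. P X}" by blast
  then have "g ` set ks = front (insert v V)" using front_insert[OF fin v] img by (simp add: P_def)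
  moreover have "distinct (map g ks)"
    using inj distinct_cands_list[of M Fs "length Fs"]
    by (auto simp: ks_def Cs_def distinct_map intro: inj_on_subset)
  ultimately show ?thesis
    using len(2) by (auto simp: lists_front_def g_def[abs_def] image_image o_def ks_def)
qed

end

section \<open>The sweep\<close>

definition process :: com where
  "process = seq [mark_all, collect, prune, rebuild]"

lemma regs_arrs_process [simp]:
  "regs_of process = {''p'', ''r'', ''x'', ''h'', ''rp'', ''fp'', ''cs'', ''j'',
    ''o'', ''b'', ''o2'', ''b2'', ''dead'', ''d'', ''c'', ''nk'', ''z'', ''ft'', ''dt'',
    ''nb'', ''nd'', ''fb'', ''db'', ''fs''}"
  "arrs_of process = {''mk'', ''cv'', ''cn'', ''hit'', ''or'', ''nw'', ''rl'', ''ko'', ''kw'',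
    ''D'', ''ce'', ''sz''}"
  by (auto simp: process_def)

locale graph_input =
  fixes n :: nat and es :: "(nat \<times> nat) list"
  assumes es_less: "set es \<subseteq> {..<n} \<times> {..<n}" and distinct_es: "distinct es"
    and acyclic_es: "acyclic (set es)"
begin

abbreviation E :: "(nat \<times> nat) set" where "E \<equiv> set es"

sublocale porder "E\<^sup>*"
  using acyclic_es
  by unfold_locales (auto simp: refl_rtrancl trans_rtrancl acyclic_impl_antisym_rtrancl)

text \<open>\<open>rev\<close> because arcs are read in input order and pushed at the front.\<close>

definition in_list :: "nat \<Rightarrow> nat list" where
  "in_list v = rev (map fst (filter (\<lambda>e. snd e = v) es))"

lemma set_in_list: "set (in_list v) = {u. (u, v) \<in> E}"
  by (force simp: in_list_def)

text \<open>The form in which the topological order enters: if \<open>V\<close> is closed and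
  \<open>v\<close> is outside, then \<open>v\<close> reaches nothing in \<open>V\<close>; if
  \<open>insert v V\<close> is closed too, acyclicity puts all in-neighbours of \<open>v\<close>
  into \<open>V\<close>, so their reach lists exist.\<close>

definition in_closed :: "nat set \<Rightarrow> bool" where
  "in_closed V \<longleftrightarrow> (\<forall>u x. (u, x) \<in> E \<longrightarrow> x \<in> V \<longrightarrow> u \<in> V)"

lemma in_closed_rtrancl: "(a, x) \<in> E\<^sup>* \<Longrightarrow> in_closed V \<Longrightarrow> x \<in> V \<Longrightarrow> a \<in> V"
  by (induction rule: converse_rtrancl_induct) (auto simp: in_closed_def)

end

text \<open>An upper bound \<open>k\<close> that lives in the analysis only;
  \<open>solve_correct\<close> instantiates it with the width.\<close>

locale graph_width = graph_input +
  fixes k :: nat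
  assumes card_le: "\<And>X. X \<subseteq> {..<n} \<Longrightarrow> indep X \<Longrightarrow> card X \<le> k"
begin

text \<open>Entries must be sound, but completeness is asked only for members of current antichains.
  Stale entries are harmless, so the list of an old vertex stays valid unchanged; the
  \<open>+ 1\<close> is the vertex itself.\<close>

definition alive_list :: "nat set \<Rightarrow> nat list list \<Rightarrow> nat \<Rightarrow> nat list \<Rightarrow> bool" where
  "alive_list V Fs u R \<longleftrightarrow> length R \<le> k * 2 ^ k + 1 \<and> set R \<subseteq> {a \<in> V. (a, u) \<in> E\<^sup>*} \<and>
    (\<forall>A\<in>set Fs. \<forall>a\<in>set A. (a, u) \<in> E\<^sup>* \<longrightarrow> a \<in> set R)"

definition sweep_inv :: "nat set \<Rightarrow> state \<Rightarrow> bool" where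
  "sweep_inv V s \<longleftrightarrow> (\<exists>Fs. lists_front V Fs \<and> frontier s Fs \<and>
    (\<forall>i<length Fs. \<forall>j<length Fs. arr s ''D'' (reg s ''db'' + (i * length Fs + j)) =
      (if set (Fs ! j) \<subseteq> E\<^sup>* `` set (Fs ! i) then 1 else 0)) \<and>
    (\<forall>u\<in>V. \<exists>R. lst s (arr s ''rl'' u) R \<and> alive_list V Fs u R)) \<and>
    (\<forall>a. arr s ''mk'' a = 0 \<or> arr s ''mk'' a \<in> Suc ` V) \<and>
    (\<forall>v<n. lst s (arr s ''il'' v) (in_list v))"

lemma sum_list_length_le:
  "(\<And>x. x \<in> set xs \<Longrightarrow> f x \<le> b) \<Longrightarrow> (\<Sum>x\<leftarrow>xs. f x) \<le> length xs * (b :: nat)"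
  by (induction xs) (auto intro: add_mono)

text \<open>An in-neighbour costs its list of length at most \<open>k * 2 ^ k + 1\<close> plus one
  iteration. \<open>B2\<close> bounds a doubly nested loop over at most \<open>2 * 2 ^ k\<close>
  candidates and is paid twice, for \<open>prune\<close> and for \<open>rebuild\<close>.\<close>

lemma wp_process:
  fixes V v
  defines "B2 \<equiv> 2 * 2 ^ k * (2 * 2 ^ k + 1)"
  assumes inv: "sweep_inv V s0" and v: "reg s0 ''v'' = v" "v < n" "v \<notin> V"
    and V: "V \<subseteq> {..<n}" "in_closed V" "in_closed (insert v V)"
  shows "wp process (length (in_list v) * (k * 2 ^ k + 2) + (2 ^ k * (k + 1) + (B2 + B2)))
    (sweep_inv (insert v V)) s0"
proof -
  have finV: "finite V" using V(1) finite_subset by blast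
  have cardV: "\<And>X. X \<subseteq> V \<Longrightarrow> indep X \<Longrightarrow> card X \<le> k" using card_le V by blast
  have nov: "(v, x) \<notin> E\<^sup>*" if "x \<in> V" for x using in_closed_rtrancl[OF _ V(2)] that v by blast
  have preds: "u \<in> V" if "(u, v) \<in> E" for u
    using V(3) that acyclic_es by (auto simp: in_closed_def acyclic_def)
  obtain Fs where lf: "lists_front V Fs" and fr: "frontier s0 Fs"
    and D: "\<And>i j. i < length Fs \<Longrightarrow> j < length Fs \<Longrightarrow>
      arr s0 ''D'' (reg s0 ''db'' + (i * length Fs + j)) =
      (if set (Fs ! j) \<subseteq> E\<^sup>* `` set (Fs ! i) then 1 else 0)"
    and RL: "\<forall>u\<in>V. \<exists>R. lst s0 (arr s0 ''rl'' u) R \<and> alive_list V Fs u R"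
    and mk: "\<And>a. arr s0 ''mk'' a = 0 \<or> arr s0 ''mk'' a \<in> Suc ` V"
    and il: "\<And>v. v < n \<Longrightarrow> lst s0 (arr s0 ''il'' v) (in_list v)"
    using inv unfolding sweep_inv_def by blast
  obtain R where R: "\<And>u. u \<in> V \<Longrightarrow> lst s0 (arr s0 ''rl'' u) (R u) \<and> alive_list V Fs u (R u)"
    using RL by metis
  have bnd: "length Fs \<le> 2 ^ k" "\<And>A. A \<in> set Fs \<Longrightarrow> length A \<le> k \<and> set A \<subseteq> V"
    using lists_front_bounds[OF lf finV, of k] cardV by blast+
  define M where "M a \<longleftrightarrow> (\<exists>u\<in>set (in_list v). a \<in> set (R u))" for a
  have M: "M a \<longleftrightarrow> (a, v) \<in> E\<^sup>*" if "A \<in> set Fs" "a \<in> set A" for A a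
  proof
    assume "M a"
    then obtain u where "(u, v) \<in> E" "a \<in> set (R u)" by (auto simp: M_def set_in_list)
    then show "(a, v) \<in> E\<^sup>*"
      using R[OF preds] by (auto simp: alive_list_def intro: rtrancl_into_rtrancl)
  next
    \<comment> \<open>The last arc of the path enters \<open>v\<close> from some \<open>u\<close> in
      \<open>V\<close>. As \<open>a\<close> is on a current antichain, the list of \<open>u\<close>
      is sure to contain it.\<close>
    assume "(a, v) \<in> E\<^sup>*"
    moreover have "a \<noteq> v" using bnd(2)[OF that(1)] that(2) v by blast
    ultimately obtain u where u: "(a, u) \<in> E\<^sup>*" "(u, v) \<in> E" by (metis rtranclE)
    then have "a \<in> set (R u)" using R[OF preds[OF u(2)]] that by (auto simp: alive_list_def)
    then show "M a" using u by (auto simp: M_def set_in_list)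
  qed
  have MV: "a \<in> V" "(a, v) \<in> E\<^sup>*" if "M a" for a
    using that R[OF preds] by (auto simp: M_def set_in_list alive_list_def intro: rtrancl_into_rtrancl)
  define Cs where "Cs = cands_list M Fs (length Fs)"
  define K where "K c d \<longleftrightarrow> length (ext v Fs c) = length (ext v Fs d) \<and>
      set (ext v Fs d) \<subseteq> E\<^sup>* `` set (ext v Fs c) \<and> c \<noteq> d" for c d
  define ks where "ks = filter (\<lambda>c. \<not> (\<exists>d\<in>set Cs. K c d)) Cs"
  have lf': "lists_front (insert v V) (map (ext v Fs) ks)"
    unfolding ks_def Cs_def using M
    by (intro lists_front_step[OF finV v(3) nov lf]) (auto simp: K_def)
  have lenC: "length Cs \<le> 2 * 2 ^ k"
    using length_cands_list[of M Fs "length Fs"] bnd(1) by (simp add: Cs_def)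
  then have B2C: "length Cs * (length Cs + 1) \<le> B2" unfolding B2_def by (intro mult_le_mono) auto
  have "length ks \<le> length Cs" by (simp add: ks_def)
  then have B2K: "length ks * (length ks + 1) \<le> B2"
    using lenC unfolding B2_def by (intro mult_le_mono) auto
  have Cs: "fst c < length Fs" "snd c \<le> 1" "snd c = 1 \<Longrightarrow> \<not> (\<exists>x\<in>set (Fs ! fst c). M x)"
    if "c \<in> set Cs" for c
    using that by (auto simp: Cs_def in_cands_list)
  have Fs_V: "set (Fs ! i) \<subseteq> V" if "i < length Fs" for i using bnd(2)[of "Fs ! i"] that by simp
  have hitv: "(\<exists>x\<in>set (Fs ! i). M x) \<longleftrightarrow> v \<in> E\<^sup>* `` set (Fs ! i)" if "i < length Fs" for i
    using M[of "Fs ! i"] that by auto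
  show ?thesis
    unfolding process_def seq.simps
  proof (rule wp_Seq[where ?b2.0 = "2 ^ k * (k + 1) + (B2 + B2)"],
      rule wp_mark_all[where us = "in_list v" and R = R], goal_cases)
    case 1
    then show ?case using il v by simp
  next
    case (2 u)
    then show ?case using R preds by (auto simp: set_in_list)
  next
    case 3
    have "(\<Sum>u\<leftarrow>in_list v. length (R u) + 1) \<le> length (in_list v) * (k * 2 ^ k + 2)"
      using R preds by (intro sum_list_length_le) (fastforce simp: set_in_list alive_list_def)
    then show ?case by simp
  next
    case (4 s1)
    note [simp] = sameD[OF 4(2)]
    have mk1: "arr s1 ''mk'' a = (if M a then Suc v else arr s0 ''mk'' a)" for a
      using 4(1) v by (simp add: M_def)
    \<comment> \<open>Earlier marks are successors of members of \<open>V\<close>, and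
      \<open>v\<close> is not one of them.\<close>
    have mk0: "arr s0 ''mk'' a \<noteq> Suc v" for a using mk[of a] v by auto
    show ?case
    proof (rule wp_Seq[where ?b2.0 = "B2 + B2"], rule wp_collect[where Fs = Fs and M = M], goal_cases)
      case 1 then show ?case using fr by (simp add: frontier_def)
    next
      case (2 j) then show ?case using fr by (simp add: frontier_def)
    next
      case 3 then show ?case using fr by (simp add: frontier_def)
    next
      case (4 x) then show ?case using mk0[of x] v by (simp add: mk1)
    next
      case 5
      have "(\<Sum>A\<leftarrow>Fs. length A + 1) \<le> length Fs * (k + 1)"
        using bnd(2) by (intro sum_list_length_le) auto
      also have "\<dots> \<le> 2 ^ k * (k + 1)" using bnd(1) by (rule mult_le_mono1)
      finally show ?case by simp
    next
      case (6 s2)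
      note [simp] = sameD[OF 6(2)]
      obtain p where p: "arr s2 ''rl'' = (arr s0 ''rl'')(v := p)"
        "lst s2 p (rev (filter M (concat Fs)) @ [v])" using 6(1) v by auto
      have h12: "hext s0 s2" using 6(1) by (auto simp: hext_def)
      have hit: "arr s2 ''hit'' i = (if v \<in> E\<^sup>* `` set (Fs ! i) then 1 else 0)"
        if "i < length Fs" for i using 6(1) that hitv[OF that] by simp
      have cs: "reg s2 ''cs'' = length Cs" "pairs s2 ''or'' ''nw'' Cs"
        using 6(1) by (auto simp: Cs_def)
      have fr2: "frontier s2 Fs"
        using fr 6(1) lst_hext[OF h12] by (simp add: frontier_def)
      have cov: "covers s2 c d \<longleftrightarrow> set (ext v Fs d) \<subseteq> E\<^sup>* `` set (ext v Fs c)"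
        if c: "c \<in> set Cs" and d: "d \<in> set Cs" for c d
      proof -
        note Vc = Fs_V[OF Cs(1)[OF c]] and Vd = Fs_V[OF Cs(1)[OF d]]
        have fs: "reg s0 ''fs'' = length Fs" using fr by (simp add: frontier_def)
        have "covers s2 c d \<longleftrightarrow> set (Fs ! fst d) \<subseteq> E\<^sup>* `` set (Fs ! fst c) \<and>
            \<not> (snd c < snd d \<and> v \<notin> E\<^sup>* `` set (Fs ! fst c))"
          using D[OF Cs(1)[OF c] Cs(1)[OF d]] hit[OF Cs(1)[OF c]]
          by (simp add: covers_def fs add.assoc split: if_splits)
        moreover have "snd c = 0 \<or> snd c = 1" "snd d = 0 \<or> snd d = 1"
          using Cs(2)[OF c] Cs(2)[OF d] by auto
        ultimately show ?thesis
          using up_insert_cases[OF finV v(3) _ Vc Vd] nov by (auto simp: ext_def)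
      qed
      have kill: "kill s2 c d \<longleftrightarrow> K c d" if c: "c \<in> set Cs" and d: "d \<in> set Cs" for c d
      proof -
        have "length (ext v Fs e) = arr s2 ''sz'' (reg s2 ''fb'' + fst e) + snd e" if "e \<in> set Cs" for e
          using Cs(1,2)[OF that] fr2 by (auto simp: frontier_def ext_def)
        then show ?thesis using cov[OF c d] c d by (simp add: kill_def K_def)
      qed
      then have ks2: "filter (\<lambda>c. \<not> (\<exists>d\<in>set Cs. kill s2 c d)) Cs = ks"
        unfolding ks_def by (intro filter_cong) auto
      show ?case
      proof (rule wp_Seq[where ?b2.0 = B2], rule wp_prune[OF cs], goal_cases)
        case 1
        then show ?case using B2C by simp
      next
        case (2 s3)
        note [simp] = sameD[OF 2(2)]
        have nk: "reg s3 ''nk'' = length ks" "pairs s3 ''ko'' ''kw'' ks" using 2(1) ks2 by auto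
        have fr3: "frontier s3 Fs" using fr2 by (simp add: frontier_def)
        have ksC: "c \<in> set Cs" if "c \<in> set ks" for c using that by (simp add: ks_def)
        have covers3: "covers s3 = covers s2" by (rule covers_cong) simp_all
        show ?case
        proof (rule wp_conseq[OF wp_rebuild[OF fr3 nk]], goal_cases)
          case (1 c) then show ?case using ksC Cs(1) by blast
        next
          case 2 then show ?case by (rule B2K)
        next
          case (3 s4)
          note [simp] = sameD[OF 3(2)]
          have fr4: "frontier s4 (map (ext v Fs) ks)" using 3(1) v by simp
          have h: "hext s0 s4" using h12 3(1) by (auto simp: hext_def)
          have h2: "hext s2 s4" using 3(1) by (auto simp: hext_def)
          have new_elem: "a = v \<or> (\<exists>B\<in>set Fs. a \<in> set B)"
            if "A \<in> set (map (ext v Fs) ks)" "a \<in> set A" for A a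
            using that Cs(1)[OF ksC] by (auto simp: ext_def split: if_splits)
          have D4: "arr s4 ''D'' (reg s4 ''db'' + (i * length ks + j)) =
              (if set (ext v Fs (ks ! j)) \<subseteq> E\<^sup>* `` set (ext v Fs (ks ! i)) then 1 else 0)"
            if "i < length ks" "j < length ks" for i j
            using 3(1) that cov[OF ksC[OF nth_mem] ksC[OF nth_mem]] covers3 by auto
          have rl4: "\<exists>R. lst s4 (arr s4 ''rl'' u) R \<and>
              alive_list (insert v V) (map (ext v Fs) ks) u R" if u: "u \<in> insert v V" for u
          proof (cases "u = v")
            case True
            have "length (filter M (concat Fs)) \<le> length (concat Fs)" by (rule length_filter_le)
            also have "\<dots> \<le> length Fs * k"
              using bnd(2) by (auto simp: length_concat intro: sum_list_length_le)
            also have "\<dots> \<le> k * 2 ^ k" using bnd(1) by simp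
            finally have "alive_list (insert v V) (map (ext v Fs) ks) v (rev (filter M (concat Fs)) @ [v])"
              using MV new_elem M by (fastforce simp: alive_list_def)
            then show ?thesis using True p lst_hext[OF h2 p(2)] by auto
          next
            case False
            then have "u \<in> V" using u by simp
            then have Ru: "alive_list V Fs u (R u)" and nvu: "(v, u) \<notin> E\<^sup>*" using R nov by auto
            have "a \<in> set (R u)"
              if a: "A \<in> set (map (ext v Fs) ks)" "a \<in> set A" "(a, u) \<in> E\<^sup>*" for A a
            proof -
              have "a \<noteq> v" using a(3) nvu by blast
              then obtain B where "B \<in> set Fs" "a \<in> set B" using new_elem[OF a(1,2)] by blast
              then show ?thesis using Ru a(3) unfolding alive_list_def by blast
            qed
            then have "alive_list (insert v V) (map (ext v Fs) ks) u (R u)"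
              using Ru unfolding alive_list_def by blast
            then show ?thesis using False p R[OF \<open>u \<in> V\<close>] lst_hext[OF h] by auto
          qed
          have mk4: "arr s4 ''mk'' a = 0 \<or> arr s4 ''mk'' a \<in> Suc ` insert v V" for a
            using mk[of a] by (auto simp: mk1)
          have il4: "lst s4 (arr s4 ''il'' x) (in_list x)" if "x < n" for x
            using lst_hext[OF h il[OF that]] by simp
          show ?case unfolding sweep_inv_def
            using lf' fr4 D4 rl4 mk4 il4 by (auto intro!: exI[of _ "map (ext v Fs) ks"])
        qed
      qed
    qed
  qed
qed

end

section \<open>Adjacency lists and a topological order\<close>

definition build_lists_body :: com where
  "build_lists_body = seq
     [Assign ''x'' (Read ''tail'' (Reg ''i'')), Assign ''y'' (Read ''head'' (Reg ''i'')),
      Write ''od'' (Reg ''x'') (Plus (Read ''od'' (Reg ''x'')) (Const 1)),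
      Assign ''p'' (Read ''il'' (Reg ''y'')), push (Reg ''x'') ''p'',
      Write ''il'' (Reg ''y'') (Reg ''p''), inc ''i'']"

text \<open>Allocation starts at cell \<open>1\<close>, address \<open>0\<close> being the empty
  list.\<close>

definition build_lists :: com where
  "build_lists = seq [Assign ''fp'' (Const 1), Assign ''i'' (Const 0), while_less ''i'' ''m'' build_lists_body]"

definition sources :: com where
  "sources = seq
     [Assign ''qt'' (Const 0), Assign ''v'' (Const 0), while_less ''v'' ''n'' (seq
       [If (Equal (Read ''od'' (Reg ''v'')) (Const 0))
          (seq [Write ''q'' (Reg ''qt'') (Reg ''v''), inc ''qt'']) Skip,
        inc ''v''])]"

definition peel_inner :: com where
  "peel_inner = seq
     [Assign ''u'' (Read ''cv'' (Reg ''p'')),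
      Write ''od'' (Reg ''u'') (Minus (Read ''od'' (Reg ''u'')) (Const 1)),
      If (Equal (Read ''od'' (Reg ''u'')) (Const 0))
        (seq [Write ''q'' (Reg ''qt'') (Reg ''u''), inc ''qt'']) Skip,
      Assign ''p'' (Read ''cn'' (Reg ''p''))]"

definition peel_body :: com where
  "peel_body = seq
     [Assign ''v'' (Read ''q'' (Reg ''qh'')), Assign ''p'' (Read ''il'' (Reg ''v'')),
      while_list ''p'' peel_inner, inc ''qh'']"

text \<open>Kahn's algorithm from the sinks. The body itself advances the limit \<open>qt\<close>,
  so this is no counting loop and is verified with \<open>wp_While\<close>.\<close>

definition peel :: com where
  "peel = seq [Assign ''qh'' (Const 0), while_less ''qh'' ''qt'' peel_body]"

lemma regs_arrs_build_lists [simp]: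
  "regs_of build_lists_body = {''x'', ''y'', ''p'', ''fp'', ''i''}"
  "arrs_of build_lists_body = {''od'', ''cv'', ''cn'', ''il''}"
  "regs_of build_lists = {''x'', ''y'', ''p'', ''fp'', ''i''}"
  "arrs_of build_lists = {''od'', ''cv'', ''cn'', ''il''}"
  "regs_of sources = {''qt'', ''v''}" "arrs_of sources = {''q''}"
  "regs_of peel_inner = {''u'', ''p'', ''qt''}" "arrs_of peel_inner = {''od'', ''q''}"
  "regs_of peel_body = {''u'', ''p'', ''qt'', ''v'', ''qh''}" "arrs_of peel_body = {''od'', ''q''}"
  "regs_of peel = {''u'', ''p'', ''qt'', ''v'', ''qh''}" "arrs_of peel = {''od'', ''q''}"
  by (auto simp: build_lists_body_def build_lists_def sources_def peel_inner_def peel_body_def peel_def)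

context graph_input
begin

lemma wp_build_lists:
  assumes "reg s0 ''m'' = length es"
    and "\<And>i. i < length es \<Longrightarrow> arr s0 ''tail'' i = fst (es ! i) \<and> arr s0 ''head'' i = snd (es ! i)"
    and "\<And>v. arr s0 ''il'' v = 0" "\<And>v. arr s0 ''od'' v = 0"
  shows "wp build_lists (length es) (\<lambda>s. 0 < reg s ''fp'' \<and> (\<forall>v. lst s (arr s ''il'' v) (in_list v)) \<and>
    (\<forall>u. arr s ''od'' u = length (filter (\<lambda>e. fst e = u) es))) s0"
  unfolding build_lists_def seq.simps
proof ((rule wp_pre, simp)+, rule wp_while_less[where N = "length es" and f = "\<lambda>_. 0" and
      I = "\<lambda>j s. 0 < reg s ''fp'' \<and>
        (\<forall>v. lst s (arr s ''il'' v) (rev (map fst (filter (\<lambda>e. snd e = v) (take j es))))) \<and>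
        (\<forall>u. arr s ''od'' u = length (filter (\<lambda>e. fst e = u) (take j es)))"], goal_cases)
  case (5 j s)
  note [simp] = sameD[OF 5(3)] 5(4)
  have e: "arr s0 ''tail'' j = fst (es ! j)" "arr s0 ''head'' j = snd (es ! j)"
    using assms(2) 5(1) by auto
  show ?case unfolding build_lists_body_def using 5(1,2)
    by (intro wp_loopfree) (auto simp: e take_Suc_conv_app_nth islist_fresh)
qed (use assms in \<open>auto simp: in_list_def\<close>)

text \<open>\<open>Q\<close> lists the vertices all of whose outgoing arcs have been removed, \<open>X\<close> being the
  set of removed arcs; every vertex comes after its out-neighbours.\<close>

definition queue :: "(nat \<times> nat) set \<Rightarrow> nat list \<Rightarrow> state \<Rightarrow> bool" where
  "queue X Q s \<longleftrightarrow> distinct Q \<and> set Q \<subseteq> {..<n} \<and> reg s ''qt'' = length Q \<and>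
    (\<forall>i<length Q. arr s ''q'' i = Q ! i) \<and>
    (\<forall>u<n. arr s ''od'' u = card {x. (u, x) \<in> E - X} \<and> (u \<in> set Q \<longleftrightarrow> {x. (u, x) \<in> E - X} = {})) \<and>
    (\<forall>a<length Q. \<forall>x. (Q ! a, x) \<in> E \<longrightarrow> x \<in> set (take a Q))"

lemma finite_out: "finite {x. (u, x) \<in> E - X}"
  by (rule finite_subset[of _ "snd ` E"]) force+

lemma length_out: "length (filter (\<lambda>e. fst e = u) es) = card {x. (u, x) \<in> E}"
proof -
  have "set (filter (\<lambda>e. fst e = u) es) = Pair u ` {x. (u, x) \<in> E}" by auto
  then have "card (set (filter (\<lambda>e. fst e = u) es)) = card {x. (u, x) \<in> E}"
    by (simp add: card_image inj_on_def)
  then show ?thesis using distinct_es by (simp add: distinct_card del: set_filter)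
qed

lemma wp_sources:
  assumes "reg s0 ''n'' = n" "\<And>u. arr s0 ''od'' u = length (filter (\<lambda>e. fst e = u) es)"
  shows "wp sources n (\<lambda>s. \<exists>Q. queue {} Q s) s0"
  unfolding sources_def seq.simps
proof ((rule wp_pre, simp)+, rule wp_while_less[where N = n and f = "\<lambda>_. 0" and
      I = "\<lambda>j s. reg s ''qt'' = length (filter (\<lambda>u. {x. (u, x) \<in> E} = {}) [0..<j]) \<and>
        (\<forall>i<length (filter (\<lambda>u. {x. (u, x) \<in> E} = {}) [0..<j]).
          arr s ''q'' i = filter (\<lambda>u. {x. (u, x) \<in> E} = {}) [0..<j] ! i)"], goal_cases)
  case (5 j s)
  note [simp] = sameD[OF 5(3)] 5(4)
  have od: "arr s0 ''od'' j = 0 \<longleftrightarrow> {x. (j, x) \<in> E} = {}"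
    using finite_out[of j "{}"] by (simp add: assms(2) length_out)
  show ?case using 5(2) by (intro wp_loopfree) (auto simp: od nth_append less_Suc_eq)
next
  case (6 s)
  note [simp] = sameD[OF 6(2)]
  have "queue {} (filter (\<lambda>u. {x. (u, x) \<in> E} = {}) [0..<n]) s"
    unfolding queue_def
  proof (intro conjI allI impI, goal_cases)
    case (7 a x)
    then have "filter (\<lambda>u. {x. (u, x) \<in> E} = {}) [0..<n] ! a \<in> set (filter (\<lambda>u. {x. (u, x) \<in> E} = {}) [0..<n])"
      by (intro nth_mem)
    then show ?case using 7 by simp
  qed (use 6(1) in \<open>auto simp: assms(2) length_out\<close>)
  then show ?case by blast
qed (use assms in auto)

text \<open>An out-degree of at most \<open>1\<close> before the decrement means that
  \<open>(u, v)\<close> was the last remaining arc of \<open>u\<close>. As heads of removed arcs are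
  queued already, appending \<open>u\<close> keeps it behind all its out-neighbours.\<close>

lemma queue_remove:
  assumes Q: "queue X Q s" and e: "(u, v) \<in> E - X" and X: "insert v (snd ` X) \<subseteq> set Q"
    and s': "reg s' ''qt'' = (if arr s ''od'' u \<le> 1 then Suc (reg s ''qt'') else reg s ''qt'')"
      "arr s' ''od'' = (arr s ''od'')(u := arr s ''od'' u - 1)"
      "arr s' ''q'' = (if arr s ''od'' u \<le> 1 then (arr s ''q'')(reg s ''qt'' := u) else arr s ''q'')"
  shows "queue (insert (u, v) X) (if arr s ''od'' u \<le> 1 then Q @ [u] else Q) s'"
proof -
  have u: "u < n" using e es_less by auto
  have out: "{x. (u, x) \<in> E - insert (u, v) X} = {x. (u, x) \<in> E - X} - {v}" by auto
  have other: "{x. (u', x) \<in> E - insert (u, v) X} = {x. (u', x) \<in> E - X}" if "u' \<noteq> u" for u'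
    using that by auto
  have od: "arr s ''od'' u = card {x. (u, x) \<in> E - X}" using Q u by (simp add: queue_def)
  have c: "card ({x. (u, x) \<in> E - X} - {v}) = card {x. (u, x) \<in> E - X} - 1"
    using e by (subst card_Diff_singleton) auto
  have uQ: "u \<notin> set Q" using Q u e by (auto simp: queue_def)
  have od1: "arr s ''od'' u \<le> 1 \<longleftrightarrow> {x. (u, x) \<in> E - X} - {v} = {}"
  proof -
    have "card {x. (u, x) \<in> E - X} \<noteq> 0" using e finite_out[of u X] by auto
    then have "arr s ''od'' u \<le> 1 \<longleftrightarrow> card ({x. (u, x) \<in> E - X} - {v}) = 0"
      using c od by linarith
    then show ?thesis using finite_out[of u X] by simp
  qed
  show ?thesis
  proof (cases "arr s ''od'' u \<le> 1")
    case True
    then have sub: "{x. (u, x) \<in> E} \<subseteq> set Q" using od1 X by force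
    have "(Q @ [u]) ! a = (if a < length Q then Q ! a else u)" if "a < length (Q @ [u])" for a
      using that by (auto simp: nth_append less_Suc_eq)
    then have "x \<in> set (take a (Q @ [u]))" if "a < length (Q @ [u])" "((Q @ [u]) ! a, x) \<in> E" for a x
      using that sub Q by (auto simp: queue_def split: if_splits)
    moreover have "distinct (Q @ [u])" "set (Q @ [u]) \<subseteq> {..<n}" "reg s' ''qt'' = length (Q @ [u])"
      "\<forall>i<length (Q @ [u]). arr s' ''q'' i = (Q @ [u]) ! i"
      using Q True u uQ s' by (auto simp: queue_def nth_append less_Suc_eq)
    moreover have "arr s' ''od'' u' = card {x. (u', x) \<in> E - insert (u, v) X} \<and>
        (u' \<in> set (Q @ [u]) \<longleftrightarrow> {x. (u', x) \<in> E - insert (u, v) X} = {})" if "u' < n" for u'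
      using Q that True od1 od c s' out other[of u'] by (cases "u' = u") (simp_all add: queue_def)
    ultimately show ?thesis
      unfolding if_P[OF True] queue_def by blast
  next
    case False
    have "arr s' ''od'' u' = card {x. (u', x) \<in> E - insert (u, v) X} \<and>
        (u' \<in> set Q \<longleftrightarrow> {x. (u', x) \<in> E - insert (u, v) X} = {})" if "u' < n" for u'
      using Q that False od1 od c s' uQ out other[of u'] by (cases "u' = u") (simp_all add: queue_def)
    then show ?thesis using Q False s' unfolding queue_def by simp
  qed
qed

lemma distinct_in_list: "distinct (in_list v)"
  using distinct_es by (auto simp: in_list_def distinct_map inj_on_def prod_eq_iff)

lemma wp_peel:
  assumes il: "\<And>v. v < n \<Longrightarrow> lst s0 (arr s0 ''il'' v) (in_list v)" and Q0: "queue {} Q0 s0"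
  shows "wp peel (\<Sum>v<n. length (in_list v) + 1)
    (\<lambda>s. \<exists>Q. distinct Q \<and> set Q = {..<n} \<and> (\<forall>i<n. arr s ''q'' i = Q ! i) \<and>
      (\<forall>a<n. \<forall>x. (Q ! a, x) \<in> E \<longrightarrow> x \<in> set (take a Q))) s0"
proof -
  \<comment> \<open>Removed are the arcs into the first \<open>j\<close> entries. \<open>Q\<close>
    is part of the ghost state because it still grows; the potential sums over vertices not yet
    dequeued, so appending to \<open>Q\<close> leaves it alone.\<close>
  define X where "X j Q = {e \<in> E. snd e \<in> set (take j Q)}" for j and Q :: "nat list"
  define \<phi> where "\<phi> g = (case g of (j, Q) \<Rightarrow> \<Sum>v\<in>{..<n} - set (take j Q). length (in_list v) + 1)" for g
  define I where "I g s = (case g of (j, Q) \<Rightarrow> j \<le> length Q \<and> reg s ''qh'' = j \<and> queue (X j Q) Q s)" for g s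
  show ?thesis
    unfolding peel_def seq.simps
  proof (rule wp_pre, simp, unfold while_less_def, rule wp_While[where I = I and \<phi> = \<phi> and g = "(0, Q0)"], goal_cases)
    case (1 g s)
    obtain j Q where g: "g = (j, Q)" by fastforce
    note [simp] = sameD[OF 1(2)]
    have q: "queue (X j Q) Q s" and qh [simp]: "reg s ''qh'' = j" and j: "j < length Q"
      using 1(1,3) by (auto simp: I_def g queue_def)
    define v where "v = Q ! j"
    have v: "v < n" "arr s ''q'' j = v" "v \<notin> set (take j Q)" "take (Suc j) Q = take j Q @ [v]"
    proof -
      show "take (Suc j) Q = take j Q @ [v]" using j by (simp add: take_Suc_conv_app_nth v_def)
      moreover have "distinct (take (Suc j) Q)" using q by (simp add: queue_def)
      ultimately show "v \<notin> set (take j Q)" by simp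
      show "v < n" "arr s ''q'' j = v" using q j subsetD[OF _ nth_mem[OF j], of "{..<n}"] by (auto simp: queue_def v_def)
    qed
    have body: "wp peel_body (length (in_list v))
        (\<lambda>s'. \<exists>zs. reg s' ''qh'' = Suc j \<and> queue (X (Suc j) (Q @ zs)) (Q @ zs) s') s"
      unfolding peel_body_def seq.simps
    proof ((rule wp_pre, simp)+, rule wp_while_list_Seq[where xs = "in_list v" and f = "\<lambda>_. 0"
          and ?b1.0 = 0 and I = "\<lambda>i s'. \<exists>zs.
            queue (X j Q \<union> (\<lambda>u. (u, v)) ` set (take i (in_list v))) (Q @ zs) s'"], goal_cases)
      case 1
      then show ?case using il[OF v(1)] v by simp
    next
      case 2
      then show ?case using q by (auto simp: queue_def intro!: exI[of _ "[]"])
    next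
      case 3
      then show ?case by simp
    next
      case (4 i s1)
      note [simp] = sameD[OF 4(3)]
      let ?X = "X j Q \<union> (\<lambda>u. (u, v)) ` set (take i (in_list v))"
      obtain zs where zs: "queue ?X (Q @ zs) s1" using 4(2) by blast
      define u where "u = in_list v ! i"
      have ti: "take (Suc i) (in_list v) = take i (in_list v) @ [u]"
        using 4(1) by (simp add: take_Suc_conv_app_nth u_def)
      moreover have "distinct (take (Suc i) (in_list v))" using distinct_in_list by simp
      ultimately have "u \<notin> set (take i (in_list v))" by simp
      moreover have "(u, v) \<in> E" using 4(1) nth_mem[of i "in_list v"] by (simp add: u_def set_in_list)
      ultimately have e: "(u, v) \<in> E - ?X" using v(3) by (auto simp: X_def)
      have sub: "insert v (snd ` ?X) \<subseteq> set (Q @ zs)"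
        using j by (auto simp: X_def v_def dest: in_set_takeD)
      let ?s2 = "eff peel_inner s1"
      have "queue (insert (u, v) ?X) (if arr s1 ''od'' u \<le> 1 then (Q @ zs) @ [u] else Q @ zs) ?s2"
        by (rule queue_remove[OF zs e sub]) (use 4(6) in \<open>auto simp: peel_inner_def u_def\<close>)
      moreover have "(if arr s1 ''od'' u \<le> 1 then (Q @ zs) @ [u] else Q @ zs) =
          Q @ (if arr s1 ''od'' u \<le> 1 then zs @ [u] else zs)" by simp
      moreover have "insert (u, v) ?X = X j Q \<union> (\<lambda>u. (u, v)) ` set (take (Suc i) (in_list v))"
        by (simp add: ti)
      ultimately have "\<exists>zs. queue (X j Q \<union> (\<lambda>u. (u, v)) ` set (take (Suc i) (in_list v))) (Q @ zs) ?s2"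
        by (simp only:) blast
      moreover have "lst ?s2 (reg ?s2 ''p'') (drop (Suc i) (in_list v))"
      proof -
        have "reg ?s2 ''p'' = arr s1 ''cn'' (reg s1 ''p'')" "arr ?s2 ''cv'' = arr s1 ''cv''"
          "arr ?s2 ''cn'' = arr s1 ''cn''" "reg ?s2 ''fp'' = reg s1 ''fp''"
          unfolding peel_inner_def by simp_all
        then show ?thesis using 4(7) by metis
      qed
      moreover have "loopfree peel_inner" by (simp add: peel_inner_def)
      ultimately show ?case by (blast intro: wp_loopfree)
    next
      case (5 s1)
      note [simp] = sameD[OF 5(2)]
      obtain zs where zs: "queue (X j Q \<union> (\<lambda>u. (u, v)) ` set (in_list v)) (Q @ zs) s1" using 5(1) by auto
      moreover have "X j Q \<union> (\<lambda>u. (u, v)) ` set (in_list v) = X (Suc j) (Q @ zs)"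
        using v(4) j by (force simp: X_def set_in_list)
      ultimately show ?case
        by (intro wp_loopfree) (auto simp: queue_def intro!: exI[of _ zs])
    qed
    have pay: "\<phi> (Suc j, Q @ zs) + length (in_list v) + 1 \<le> \<phi> g" for zs
    proof -
      have "{..<n} - set (take j Q) = insert v ({..<n} - set (take (Suc j) (Q @ zs)))"
        using v j by auto
      moreover have "v \<notin> {..<n} - set (take (Suc j) (Q @ zs))" using v j by simp
      ultimately show ?thesis by (simp add: \<phi>_def g)
    qed
    have "wp peel_body (length (in_list v))
        (\<lambda>s'. \<exists>g'. I g' s' \<and> \<phi> g' + length (in_list v) + 1 \<le> \<phi> g) s"
    proof (rule wp_conseq[OF body order_refl])
      fix s' assume "\<exists>zs. reg s' ''qh'' = Suc j \<and> queue (X (Suc j) (Q @ zs)) (Q @ zs) s'"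
      then obtain zs where "reg s' ''qh'' = Suc j" "queue (X (Suc j) (Q @ zs)) (Q @ zs) s'" by blast
      then have "I (Suc j, Q @ zs) s'" using j by (simp add: I_def)
      then show "\<exists>g'. I g' s' \<and> \<phi> g' + length (in_list v) + 1 \<le> \<phi> g" using pay by blast
    qed
    then show ?case by blast
  next
    case (2 g s)
    obtain j Q where g: "g = (j, Q)" by fastforce
    have q: "queue (X j Q) Q s" and j: "j = length Q"
      using 2(1,3) by (auto simp: I_def g queue_def)
    \<comment> \<open>Choose a missing vertex all of whose out-neighbours are queued. Every queued
      vertex has been dequeued, so all its arcs are removed and it should be in the queue.\<close>
    have "set Q = {..<n}"
    proof (rule ccontr)
      assume "set Q \<noteq> {..<n}"
      then have "{..<n} - set Q \<noteq> {}" using q by (auto simp: queue_def)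
      moreover have "wf (E\<inverse>)" using acyclic_es by (intro finite_acyclic_wf_converse) auto
      ultimately obtain u where u: "u \<in> {..<n} - set Q"
        "\<And>x. (x, u) \<in> E\<inverse> \<Longrightarrow> x \<notin> {..<n} - set Q" by (metis ex_in_conv wfE_min)
      then obtain x where "(u, x) \<in> E" "(u, x) \<notin> X j Q" using q by (auto simp: queue_def)
      then have "x \<in> {..<n} - set Q" using es_less j by (auto simp: X_def)
      then show False using u(2) \<open>(u, x) \<in> E\<close> by blast
    qed
    moreover then have "length Q = n" using q by (metis card_lessThan distinct_card queue_def)
    ultimately show ?case using q by (auto simp: queue_def)
  next
    case 3
    then show ?case using Q0 by (simp add: I_def X_def queue_def)
  next
    case 4
    then show ?case by (simp add: \<phi>_def)
  qed
qed

end

section \<open>The whole algorithm\<close>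

text \<open>The frontier of the empty vertex set: one empty antichain, whose address and size are
  the initial zeros of memory, with a matrix consisting of a single \<open>1\<close>.\<close>

definition main_init :: com where
  "main_init = seq
     [Assign ''fb'' (Const 0), Assign ''db'' (Const 0), Assign ''fs'' (Const 1),
      Assign ''ft'' (Const 1), Assign ''dt'' (Const 1), Write ''D'' (Const 0) (Const 1),
      Assign ''i'' (Reg ''n'')]"

text \<open>The queue is read backwards, as it lists every vertex after its out-neighbours.\<close>

definition main_body :: com where
  "main_body = seq
     [Assign ''i'' (Minus (Reg ''i'') (Const 1)), Assign ''v'' (Read ''q'' (Reg ''i'')), process]"

definition main_loop :: com where
  "main_loop = While (Less (Const 0) (Reg ''i'')) main_body"

definition find_largest :: com where
  "find_largest = seq
     [Assign ''b'' (Const 0), Assign ''j'' (Const 0), while_less ''j'' ''fs'' (seq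
       [If (Less (Read ''sz'' (Plus (Reg ''fb'') (Reg ''b''))) (Read ''sz'' (Plus (Reg ''fb'') (Reg ''j''))))
          (Assign ''b'' (Reg ''j'')) Skip,
        inc ''j''])]"

definition write_out :: com where
  "write_out = seq
     [Assign ''p'' (Read ''ce'' (Plus (Reg ''fb'') (Reg ''b''))), Assign ''size'' (Const 0),
      while_list ''p'' (seq
       [Write ''out'' (Reg ''size'') (Read ''cv'' (Reg ''p'')), inc ''size'',
        Assign ''p'' (Read ''cn'' (Reg ''p''))])]"

definition solve :: com where
  "solve = seq [build_lists, sources, peel, main_init, main_loop, find_largest, write_out]"

lemma regs_arrs_main [simp]:
  "regs_of find_largest = {''b'', ''j''}" "arrs_of find_largest = {}"
  "loopfree main_init"
  by (auto simp: find_largest_def main_init_def)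

lemma slow_solve: "slow_com solve"
  by (simp add: solve_def build_lists_def build_lists_body_def sources_def peel_def peel_body_def
      peel_inner_def main_init_def main_loop_def main_body_def process_def mark_all_def mark_row_def
      collect_def collect_body_def scan_def prune_def prune_body_def prune_inner_def rebuild_def
      rebuild_body_def rebuild_inner_def kill_test_def covers_test_def find_largest_def
      write_out_def inc_def push_def while_list_def while_less_def)

lemma wp_find_largest:
  assumes fr: "frontier s0 Fs" and ne: "Fs \<noteq> []"
  shows "wp find_largest (length Fs) (\<lambda>s. reg s ''b'' < length Fs \<and>
    (\<forall>j<length Fs. length (Fs ! j) \<le> length (Fs ! reg s ''b''))) s0"
  unfolding find_largest_def seq.simps
proof ((rule wp_pre, simp)+, rule wp_while_less[where N = "length Fs" and f = "\<lambda>_. 0" and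
      I = "\<lambda>j s. reg s ''b'' < length Fs \<and>
        (\<forall>i<j. length (Fs ! i) \<le> length (Fs ! reg s ''b''))"], goal_cases)
  case (5 j s)
  note [simp] = sameD[OF 5(3)] 5(4)
  have "arr s0 ''sz'' (reg s0 ''fb'' + i) = length (Fs ! i)" if "i < length Fs" for i
    using fr that by (simp add: frontier_def)
  then show ?case using 5(1,2) by (intro wp_loopfree) (auto simp: less_Suc_eq)
qed (use ne fr in \<open>auto simp: frontier_def\<close>)

lemma wp_write_out:
  assumes "lst s0 (arr s0 ''ce'' (reg s0 ''fb'' + reg s0 ''b'')) A"
  shows "wp write_out (length A) (\<lambda>s. output_list s = A) s0"
  unfolding write_out_def seq.simps
proof ((rule wp_pre, simp)+, rule wp_while_list[where xs = A and f = "\<lambda>_. 0" and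
      I = "\<lambda>j s. reg s ''size'' = j \<and> (\<forall>i<j. arr s ''out'' i = A ! i)"], goal_cases)
  case (4 j s)
  note [simp] = sameD[OF 4(3)]
  show ?case using 4(1,2,6,7) by (intro wp_loopfree) (auto simp: less_Suc_eq)
next
  case (5 s)
  then show ?case by (auto simp: output_list_def intro: nth_equalityI)
qed (use assms in auto)

context graph_input
begin

lemma sum_in_list: "(\<Sum>v<n. length (in_list v)) = length es"
proof -
  have "(\<Sum>v<n. length (filter (\<lambda>e. snd e = v) xs)) = length xs"
    if "set xs \<subseteq> {..<n} \<times> {..<n}" for xs :: "(nat \<times> nat) list"
    using that
  proof (induction xs)
    case (Cons e xs)
    have "(\<Sum>v<n. length (filter (\<lambda>e. snd e = v) (e # xs))) =
        (\<Sum>v<n. (if v = snd e then 1 else 0) + length (filter (\<lambda>e. snd e = v) xs))"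
      by (intro sum.cong) auto
    also have "\<dots> = 1 + length xs" using Cons by (auto simp: sum.distrib)
    finally show ?case by simp
  qed simp
  then show ?thesis using es_less by (simp add: in_list_def)
qed

end

context graph_width
begin

text \<open>The share of \<open>wp_process\<close> that does not depend on the in-degree.\<close>

definition step_cost :: nat where
  "step_cost = 2 ^ k * (k + 1) + 2 * (2 * 2 ^ k * (2 * 2 ^ k + 1))"

lemma sweep_inv_empty:
  assumes "reg s ''fs'' = 1" "reg s ''ft'' = Suc (reg s ''fb'')" "reg s ''dt'' = Suc (reg s ''db'')"
    "0 < reg s ''fp''" "arr s ''ce'' (reg s ''fb'') = 0" "arr s ''sz'' (reg s ''fb'') = 0"
    "arr s ''D'' (reg s ''db'') = 1" "\<And>a. arr s ''mk'' a = 0"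
    "\<And>v. v < n \<Longrightarrow> lst s (arr s ''il'' v) (in_list v)"
  shows "sweep_inv {} s"
  unfolding sweep_inv_def
  using assms by (auto intro!: exI[of _ "[[]]"] simp: frontier_def lists_front_def front_empty)

lemma wp_main_loop:
  assumes inv: "sweep_inv {} s0" and i: "reg s0 ''i'' = n"
    and Q: "distinct Q" "set Q = {..<n}" "\<And>i. i < n \<Longrightarrow> arr s0 ''q'' i = Q ! i"
      "\<And>a x. a < n \<Longrightarrow> (Q ! a, x) \<in> E \<Longrightarrow> x \<in> set (take a Q)"
  shows "wp main_loop (length es * (k * 2 ^ k + 2) + n * (step_cost + 1)) (sweep_inv {..<n}) s0"
proof -
  define f where "f v = length (in_list v) * (k * 2 ^ k + 2) + step_cost" for v
  have len: "length Q = n" using Q(1,2) by (metis card_lessThan distinct_card)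
  have "(\<Sum>j<n. f (Q ! (n - Suc j))) = (\<Sum>j<n. f (Q ! j))"
    by (rule sum.nat_diff_reindex)
  also have "\<dots> = (\<Sum>v<n. f v)"
    using Q(1,2) len by (intro sum.reindex_bij_betw bij_betw_nth) auto
  also have "\<dots> = (\<Sum>v<n. length (in_list v)) * (k * 2 ^ k + 2) + n * step_cost"
    unfolding f_def by (simp only: sum.distrib sum_distrib_right) simp
  also have "\<dots> = length es * (k * 2 ^ k + 2) + n * step_cost"
    by (simp only: sum_in_list)
  finally have budget: "(\<Sum>j<n. f (Q ! (n - Suc j)) + 1) =
      length es * (k * 2 ^ k + 2) + n * (step_cost + 1)"
    by (simp only: sum.distrib) simp
  \<comment> \<open>If \<open>x\<close> is in the suffix and \<open>u\<close> has an arc to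
    \<open>x\<close>, then \<open>u\<close> stands behind \<open>x\<close> in \<open>Q\<close> and
    so is in the suffix as well.\<close>
  have closed: "in_closed (set (drop m Q))" for m
    unfolding in_closed_def
  proof (intro allI impI)
    fix u x assume ux: "(u, x) \<in> E" "x \<in> set (drop m Q)"
    have "u \<in> set Q" using es_less ux(1) Q(2) by auto
    then obtain a where a: "a < n" "Q ! a = u" using len by (auto simp: in_set_conv_nth)
    have "x \<in> set (take a Q)" using Q(4) a ux(1) by blast
    moreover have "set (take a Q) \<inter> set (drop m Q) = {}" if "a \<le> m"
      using Q(1) that by (rule set_take_disj_set_drop_if_distinct)
    ultimately have "m \<le> a" using ux(2) by (meson disjoint_iff nat_le_linear)
    then have "drop m Q ! (a - m) = u" "a - m < length (drop m Q)" using a len by auto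
    then show "u \<in> set (drop m Q)" by (metis nth_mem)
  qed
  show ?thesis
    unfolding main_loop_def
  proof (rule wp_For[where N = n and f = "\<lambda>j. f (Q ! (n - Suc j))" and
        I = "\<lambda>j s. reg s ''i'' = n - j \<and> arr s ''q'' = arr s0 ''q'' \<and> sweep_inv (set (drop (n - j) Q)) s"],
      goal_cases)
    case 1
    then show ?case using inv i len by simp
  next
    case 2
    then show ?case using budget by simp
  next
    case (3 j s)
    define v where "v = Q ! (n - Suc j)"
    have j: "n - Suc j < n" "n - j = Suc (n - Suc j)" using 3(1) by auto
    have ins: "set (drop (n - Suc j) Q) = insert v (set (drop (n - j) Q))"
      using j len Cons_nth_drop_Suc[of "n - Suc j" Q] by (metis list.simps(15) v_def)
    have d: "distinct (drop (n - Suc j) Q)" using Q(1) by simp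
    have nv: "v \<notin> set (drop (n - j) Q)"
      using d j len Cons_nth_drop_Suc[of "n - Suc j" Q] by (metis distinct.simps(2) v_def)
    define s1 where "s1 = s\<lparr>reg := (reg s)(''i'' := n - Suc j, ''v'' := v)\<rparr>"
    have inv1: "sweep_inv (set (drop (n - j) Q)) s1" using 3(2) by (simp add: sweep_inv_def frontier_def s1_def)
    have vn: "v < n" using Q(2) j len by (metis lessThan_iff nth_mem v_def)
    have sub: "set (drop (n - j) Q) \<subseteq> {..<n}" using Q(2) set_drop_subset[of "n - j" Q] by simp
    have cl: "in_closed (insert v (set (drop (n - j) Q)))" using closed[of "n - Suc j"] ins by simp
    have "reg s1 ''v'' = v" by (simp add: s1_def)
    note P = wp_process[OF inv1 this vn nv sub closed cl]
    have "wp main_body (f v) (\<lambda>s'. reg s' ''i'' = n - Suc j \<and> arr s' ''q'' = arr s0 ''q'' \<and>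
        sweep_inv (set (drop (n - Suc j) Q)) s') s"
      unfolding main_body_def seq.simps
    proof (rule wp_pre, simp, rule wp_pre, simp)
      have eq: "eff (Assign ''v'' (Read ''q'' (Reg ''i'')))
          (eff (Assign ''i'' (Minus (Reg ''i'') (Const 1))) s) = s1"
        using 3(2) Q(3)[OF j(1)] by (simp add: s1_def v_def)
      show "wp process (f v) (\<lambda>s'. reg s' ''i'' = n - Suc j \<and> arr s' ''q'' = arr s0 ''q'' \<and>
          sweep_inv (set (drop (n - Suc j) Q)) s')
          (eff (Assign ''v'' (Read ''q'' (Reg ''i'')))
            (eff (Assign ''i'' (Minus (Reg ''i'') (Const 1))) s))"
        unfolding eq
      proof (rule wp_conseq[OF P], goal_cases)
        case 1
        then show ?case by (simp add: f_def step_cost_def)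
      next
        case (2 s')
        then show ?case using sameD[OF 2(2)] 3(2) ins by (simp add: s1_def)
      qed
    qed
    then show ?case using 3(1,2) by (simp add: v_def)
  next
    case (4 s)
    then show ?case using Q(2) by simp
  qed
qed

lemma wp_solve:
  "wp solve (length es + n + (length es + n) + (length es * (k * 2 ^ k + 2) + n * (step_cost + 1)) + 2 ^ k + k)
    (\<lambda>s. distinct (output_list s) \<and> set (output_list s) \<subseteq> {..<n} \<and> indep (set (output_list s)) \<and>
      (\<forall>X. X \<subseteq> {..<n} \<longrightarrow> indep X \<longrightarrow> card X \<le> length (output_list s))) (input_state n es)"
proof -
  let ?s0 = "input_state n es"
  let ?L = "length es * (k * 2 ^ k + 2) + n * (step_cost + 1)"
  have init [simp]: "arr ?s0 a i = 0" if "a \<noteq> ''tail''" "a \<noteq> ''head''" for a i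
    using that by (simp add: input_state_def)
  have n: "reg ?s0 ''n'' = n" by (simp add: input_state_def)
  have sum1: "(\<Sum>v<n. length (in_list v) + 1) = length es + n"
    by (simp only: sum.distrib sum_in_list) simp
  show ?thesis
    unfolding solve_def seq.simps
  proof (rule wp_Seq[where ?b2.0 = "n + ((length es + n) + (?L + (2 ^ k + k)))"],
      rule wp_build_lists, goal_cases)
    case (6 s1)
    note fr1 [simp] = sameD[OF 6(2)]
    show ?case
    proof (rule wp_Seq[where ?b2.0 = "(length es + n) + (?L + (2 ^ k + k))"], rule wp_sources, goal_cases)
      case (4 s2)
      note [simp] = sameD[OF 4(2)]
      obtain Q0 where Q0: "queue {} Q0 s2" using 4(1) by blast
      show ?case
      proof (rule wp_Seq[where ?b2.0 = "?L + (2 ^ k + k)"], rule wp_peel[OF _ Q0], goal_cases)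
        case (3 s3)
        note [simp] = sameD[OF 3(2)]
        obtain Q where Q: "distinct Q" "set Q = {..<n}" "\<And>i. i < n \<Longrightarrow> arr s3 ''q'' i = Q ! i"
          "\<And>a x. a < n \<Longrightarrow> (Q ! a, x) \<in> E \<Longrightarrow> x \<in> set (take a Q)" using 3(1) by blast
        show ?case
        proof (rule wp_pre, simp, rule wp_Seq[where ?b2.0 = "2 ^ k + k"],
            rule wp_main_loop[where Q = Q], goal_cases)
          case 1
          show ?case using 6(1) by (intro sweep_inv_empty) (simp_all add: main_init_def)
        next
          case 2
          then show ?case using n by (simp add: main_init_def)
        next
          case (5 i)
          then show ?case using Q(3) by (simp add: main_init_def)
        next
          case (8 s4)
          obtain Fs where lf: "lists_front {..<n} Fs" and fr: "frontier s4 Fs"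
            using 8(1) unfolding sweep_inv_def by blast
          have bnd: "length Fs \<le> 2 ^ k" "\<And>A. A \<in> set Fs \<Longrightarrow> length A \<le> k"
            using lists_front_bounds[OF lf, of k] card_le by blast+
          \<comment> \<open>Every attainable size occurs in the final frontier, so its longest list
            is a maximum antichain.\<close>
          have dom: "\<exists>A\<in>set Fs. length A = card X" if X: "X \<subseteq> {..<n}" "indep X" for X
          proof -
            obtain Y where Y: "Y \<in> front {..<n}" "card Y = card X"
              using front_dominates[OF _ X] by auto
            then obtain A where "A \<in> set Fs" "Y = set A"
              using lf unfolding lists_front_def by blast
            then show ?thesis using lf Y(2) by (auto simp: lists_front_def distinct_card)
          qed
          have "indep {}" by (simp add: indep_def)
          then have ne: "Fs \<noteq> []" using dom[of "{}"] by auto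
          show ?case
          proof (rule wp_Seq[where ?b2.0 = k], rule wp_find_largest[OF fr ne], goal_cases)
            case 1
            then show ?case using bnd(1) by simp
          next
            case (2 s5)
            note [simp] = sameD[OF 2(2)]
            define A where "A = Fs ! reg s5 ''b''"
            have A: "A \<in> set Fs" using 2(1) by (simp add: A_def)
            have max: "length B \<le> length A" if "B \<in> set Fs" for B
              using 2(1) that by (auto simp: A_def in_set_conv_nth)
            have l: "lst s5 (arr s5 ''ce'' (reg s5 ''fb'' + reg s5 ''b'')) A"
              using 2(1) fr by (simp add: frontier_def A_def)
            have FA: "set A \<in> front {..<n}" "distinct A" using lf A by (auto simp: lists_front_def)
            show ?case
            proof (rule wp_conseq[OF wp_write_out[OF l]], goal_cases)
              case 1
              then show ?case using bnd(2)[OF A] .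
            next
              case (2 s6)
              then show ?case using FA frontD[OF FA(1)] dom max by metis
            qed
          qed
        qed (use Q in simp_all)
      qed (use 6(1) sum1 in simp_all)
    qed (use 6(1) n in simp_all)
  qed (auto simp: input_state_def)
qed

end

section \<open>Reachability by paths, and the numerical bounds\<close>

lemma reaches_iff:
  assumes "pair_fin_digraph G" "u \<in> pverts G"
  shows "reaches G u v \<longleftrightarrow> (u, v) \<in> (parcs G)\<^sup>*"
proof -
  interpret pair_fin_digraph G by fact
  have arcs: "arcs_ends (with_proj G) = parcs G"
    by (simp add: arcs_ends_conv)
  have "reachable (with_proj G) u v" if "(u, v) \<in> (parcs G)\<^sup>*"
    using that
  proof (induction rule: rtrancl_induct)
    case base
    then show ?case using assms(2) by simp
  next
    case (step y z)
    then show ?case using reachable_adj_trans[of u y z] arcs by simp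
  qed
  then show ?thesis
    unfolding reaches_def reachable_apath[symmetric] using reachable_rtranclI arcs by metis
qed

text \<open>With \<open>k > 0\<close> each term is absorbed by one of the two summands of
  \<open>T\<close>, with generous constants. The final \<open>+ 1\<close> serves the graph without
  vertices, where \<open>T = 0\<close> but \<open>2 ^ k = 1\<close>.\<close>

lemma size_bound:
  fixes k n m T :: nat
  assumes T: "T = k\<^sup>2 * 4 ^ k * n + k * 2 ^ k * m"
    and k: "n > 0 \<Longrightarrow> k > 0" "n = 0 \<Longrightarrow> m = 0 \<and> k = 0"
  shows "m + n + (m + n) + (m * (k * 2 ^ k + 2) +
      n * (2 ^ k * (k + 1) + 2 * (2 * 2 ^ k * (2 * 2 ^ k + 1)) + 1)) + 2 ^ k + k \<le> 30 * T + 1"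
    "n + m \<le> T"
proof -
  consider "n = 0" | "n > 0" "k > 0" using k by blast
  then have "m + n + (m + n) + (m * (k * 2 ^ k + 2) +
      n * (2 ^ k * (k + 1) + 2 * (2 * 2 ^ k * (2 * 2 ^ k + 1)) + 1)) + 2 ^ k + k \<le> 30 * T + 1 \<and> n + m \<le> T"
  proof cases
    case 1
    then show ?thesis using k(2) T by simp
  next
    case 2
    define W where "W = (2 :: nat) ^ k"
    have W4: "(4 :: nat) ^ k = W * W" by (simp add: W_def power_mult_distrib[symmetric])
    define P where "P = k * k * (W * W)"
    have T': "T = P * n + k * W * m" by (simp add: T P_def W4 power2_eq_square W_def)
    have W2: "2 \<le> W" using 2 by (cases k) (auto simp: W_def)
    have kW: "2 \<le> k * W" using W2 2 mult_le_mono[of 1 k 2 W] by simp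
    have WWP: "W * W \<le> P" using 2 by (simp add: P_def)
    have kWP: "k * W \<le> P"
      using mult_le_mono[of 1 "k * W" "k * W" "k * W"] kW by (simp add: P_def ac_simps)
    have "W \<le> W * W" using W2 by simp
    then have WP: "W \<le> P" using WWP by linarith
    have "k \<le> k * W" using W2 by simp
    then have kP: "k \<le> P" using kWP by linarith
    have P1: "1 \<le> P" using WP W2 by linarith
    \<comment> \<open>The left side expands to \<open>k * W + 8 * (W * W) + 5 * W + 1\<close>, that
      is, at most 15 terms each bounded by \<open>P\<close>.\<close>
    have "W * (k + 1) + 2 * (2 * W * (2 * W + 1)) + 1 \<le> 17 * P"
      using WWP kWP WP P1 by (simp add: algebra_simps)
    then have B: "n * (W * (k + 1) + 2 * (2 * W * (2 * W + 1)) + 1) \<le> 17 * (n * P)"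
      using mult_le_mono2[of _ "17 * P" n] by (simp only: mult.left_commute[of n 17 P])
    have A: "m * (k * W + 2) \<le> 2 * (m * (k * W))"
      using mult_le_mono2[of "k * W + 2" "2 * (k * W)" m] kW by (simp only: mult.left_commute[of m 2])
    have nP: "P \<le> n * P" using 2 by simp
    have arith: "m + n + (m + n) + (A + B) + W + k \<le> 30 * (a + b) + 1 \<and> n + m \<le> a + b"
      if "A \<le> 2 * b" "B \<le> 17 * a" "m \<le> b" "n \<le> a" "W \<le> a" "k \<le> a" for A B a b
      using that by simp
    have T: "T = n * P + m * (k * W)" by (simp add: T')
    have "m * 1 \<le> m * (k * W)" "n * 1 \<le> n * P"
      using kW P1 by (intro mult_le_mono2; linarith)+
    then have "m \<le> m * (k * W)" "n \<le> n * P" by (simp_all only: mult_1_right)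
    moreover have "W \<le> n * P" "k \<le> n * P" using nP WP kP by linarith+
    ultimately show ?thesis
      unfolding W_def[symmetric] T by (rule arith[OF A B])
  qed
  then show "m + n + (m + n) + (m * (k * 2 ^ k + 2) +
      n * (2 ^ k * (k + 1) + 2 * (2 * 2 ^ k * (2 * 2 ^ k + 1)) + 1)) + 2 ^ k + k \<le> 30 * T + 1"
    "n + m \<le> T" by blast+
qed

text \<open>A constant factor \<open>c\<close> turns into an exponent by
  \<open>c \<le> 2 ^ c \<le> (T + 2) ^ c\<close>; the last \<open>+ 1\<close> in the exponent makes
  the inequality strict.\<close>

lemma word_size_bound:
  fixes U T t M :: nat
  assumes "t \<le> U * (30 * T + 2)" "M \<le> T + 2" "U > 0" "(T + 2) ^ ((62 * U + 2) * U + 1) \<le> 2 ^ w"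
  shows "(M + 2 * t) ^ U < 2 ^ w"
proof -
  have "M + 2 * t \<le> (T + 2) * (60 * U + 1)"
    using assms(1,2) by (simp add: algebra_simps)
  also have "\<dots> \<le> (T + 2) * 2 ^ (60 * U + 1)"
    using less_exp[of "60 * U + 1"] by (intro mult_le_mono2) simp
  also have "\<dots> \<le> (T + 2) * (T + 2) ^ (60 * U + 1)"
    by (intro mult_le_mono2 power_mono) auto
  also have "\<dots> = (T + 2) ^ (60 * U + 2)" by simp
  also have "\<dots> \<le> (T + 2) ^ (62 * U + 2)" by (intro power_increasing) auto
  finally have "(M + 2 * t) ^ U \<le> ((T + 2) ^ (62 * U + 2)) ^ U" by (intro power_mono) auto
  also have "\<dots> = (T + 2) ^ ((62 * U + 2) * U)" by (rule power_mult[symmetric])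
  also have "\<dots> < (T + 2) ^ ((62 * U + 2) * U + 1)" by (intro power_strict_increasing) auto
  finally show ?thesis using assms(4) by (rule less_le_trans)
qed

lemma unit_cost_pos: "0 < unit_cost c"
  by (induction c) auto

lemma solve_correct:
  fixes G n es w
  defines "T \<equiv> (width G)\<^sup>2 * 4 ^ width G * card (pverts G) + width G * 2 ^ width G * card (parcs G)"
    and "U \<equiv> unit_cost solve"
  assumes G: "dag G" "represents n es G" and w: "(T + 2) ^ ((62 * U + 2) * U + 1) \<le> 2 ^ w"
  shows "\<exists>t s. exec w solve (input_state n es) t s \<and> distinct (output_list s) \<and>
    max_antichain G (set (output_list s)) \<and> (pverts G \<noteq> {} \<longrightarrow> t \<le> 32 * U * T)"
proof -
  have V: "pverts G = {..<n}" and E: "parcs G = set es" and dist: "distinct es"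
    using G(2) by (auto simp: represents_def)
  have fd: "pair_fin_digraph G" and acyc: "acyclic (set es)" using G(1) E by (auto simp: dag_def)
  interpret pair_fin_digraph G by (rule fd)
  have "set es \<subseteq> {..<n} \<times> {..<n}"
    using in_arcsD1 in_arcsD2 V E by auto
  then interpret graph_input n es
    using dist acyc by (rule graph_input.intro)
  have anti: "antichain G A \<longleftrightarrow> A \<subseteq> {..<n} \<and> indep A" for A
    unfolding antichain_def indep_def V using reaches_iff[OF fd] V E by (metis subsetD)
  have fin: "finite (card ` {A. antichain G A})"
    by (rule finite_imageI, rule finite_subset[of _ "Pow {..<n}"]) (auto simp: anti)
  have le: "card A \<le> width G" if "antichain G A" for A
    unfolding width_def using fin that by (intro Max_ge) auto
  have "antichain G {}" by (simp add: anti indep_def)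
  then have "width G \<in> card ` {A. antichain G A}"
    unfolding width_def by (intro Max_in[OF fin]) auto
  then obtain A0 where A0: "antichain G A0" "card A0 = width G" by auto
  interpret graph_width n es "width G"
    using le anti by unfold_locales auto
  have "n > 0 \<Longrightarrow> width G > 0"
    using le[of "{0}"] anti by (fastforce simp: indep_def)
  moreover have "n = 0 \<Longrightarrow> length es = 0 \<and> width G = 0"
    using es_less A0 anti by auto
  moreover have "T = (width G)\<^sup>2 * 4 ^ width G * n + width G * 2 ^ width G * length es"
    using dist by (simp add: T_def V E distinct_card)
  ultimately have size: "length es + n + (length es + n) + (length es * (width G * 2 ^ width G + 2) +
      n * (2 ^ width G * (width G + 1) + 2 * (2 * 2 ^ width G * (2 * 2 ^ width G + 1)) + 1)) +
      2 ^ width G + width G \<le> 30 * T + 1" "n + length es \<le> T"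
    using size_bound[of T "width G" n "length es"] by blast+
  \<comment> \<open>The word length \<open>w'\<close> is whatever this run needs;
    \<open>exec_slow\<close> transfers the same run to \<open>w\<close> bits below.\<close>
  obtain w' t s where ex: "exec w' solve (input_state n es) t s"
    and t: "t \<le> U * (length es + n + (length es + n) + (length es * (width G * 2 ^ width G + 2) +
      n * (step_cost + 1)) + 2 ^ width G + width G + 1)"
    and out: "distinct (output_list s)" "set (output_list s) \<subseteq> {..<n}" "indep (set (output_list s))"
      "\<And>X. X \<subseteq> {..<n} \<Longrightarrow> indep X \<Longrightarrow> card X \<le> length (output_list s)"
    using wp_solve unfolding wp_def U_def by blast
  have t': "t \<le> U * (30 * T + 2)"
    using size(1) by (intro le_trans[OF t] mult_le_mono2) (simp add: step_cost_def)
  have "antichain G (set (output_list s))" using out by (simp add: anti)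
  moreover have "width G \<le> card (set (output_list s))"
    using out(4)[of A0] A0 anti out(1) by (simp add: distinct_card)
  ultimately have max: "max_antichain G (set (output_list s))"
    using le by (simp add: max_antichain_def le_antisym)
  have "fst (es ! i) < n \<and> snd (es ! i) < n" if "i < length es" for i
    using es_less nth_mem[OF that] by (metis lessThan_iff mem_Times_iff subsetD)
  then have "bounded (T + 2) (input_state n es)"
    using size(2) by (fastforce simp: bounded_def input_state_def)
  moreover have "U > 0" by (simp add: U_def unit_cost_pos)
  then have "(T + 2 + 2 * t) ^ U < 2 ^ w" using word_size_bound[OF t' order_refl _ w] by simp
  ultimately have "exec w solve (input_state n es) t s"
    using exec_slow[OF ex _ slow_solve] by (simp add: U_def)
  moreover have "t \<le> 32 * U * T" if "pverts G \<noteq> {}"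
  proof -
    have "n \<noteq> 0" using that V by (metis lessThan_0)
    \<comment> \<open>A nonempty graph has \<open>T \<ge> 1\<close>, which absorbs the additive
      \<open>2\<close>.\<close>
    then have "1 \<le> T" using size(2) by linarith
    then have "U * (30 * T + 2) \<le> U * (32 * T)" by (intro mult_le_mono2) simp
    then show ?thesis using t' by (simp only: ac_simps)
  qed
  ultimately show ?thesis using out(1) max by blast
qed

theorem theorem1:
  shows "\<exists>P. computes_max_antichain_in_time P
    (\<lambda>G. (width G)\<^sup>2 * 4 ^ width G * card (pverts G) + width G * 2 ^ width G * card (parcs G))"
  unfolding computes_max_antichain_in_time_def using solve_correct by blast

end
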